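(* Let $\kappa$ be an uncountable regular cardinal. A Boolean algebra is $\kappa$-Corson if and only if it has Property $\mathfrak{B}_\kappa$.
   Context: A Boolean algebra $\mathbb{B}$ is $\kappa$-Corson if there is a set $G \subseteq \mathbb{B}$ generating $\mathbb{B}$ as a Boolean algebra such that $|G \cap p| < \kappa$ for every $p \in \mathrm{Ult}(\mathbb{B})$, where $\mathrm{Ult}(\mathbb{B})$ is the set of ultrafilters of $\mathbb{B}$. $H(\theta)$ is the set of all sets whose transitive closure has cardinality $<\theta$. An elementary submodel $M$ of $\langle H(\theta), \in\rangle$ is $\kappa$-stable if $\kappa \in M$ and $\kappa \cap M$ is an initial segment of $\kappa$. Given a Boolean algebra $\mathbb{B}$ and an elementary $\kappa$-stable submodel $M$ of some $H(\theta)$, $M$ is called $\mathbb{B}$-good if for every $p, q \in \mathrm{Ult}(\mathbb{B})$ such that $p \neq q$ and $p \cup q \subseteq \bigcup (\mathrm{Ult}(\mathbb{B}) \cap M)$, it holds that $p \cap M \neq q \cap M$. A Boolean algebra $\mathbb{B}$ has Property $\mathfrak{B}_\kappa$ if, for all sufficiently large regular cardinals $\theta$, every $\kappa$-stable elementary submodel $M$ of $H(\theta)$ satisfying $\mathbb{B} \in M$ and $|M| < \kappa$ is $\mathbb{B}$-good. *)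

theory Defs
  imports Main
begin

unbundle cardinal_syntax

text \<open>
  The ambient set theory. A type of class \<open>zfc_universe\<close> is a model of second-order ZFC;
  \<open>elts x\<close> is the collection of members of the set \<open>x\<close>, and a collection \<open>X :: 'v set\<close>
  is (the extension of) a set iff \<open>X \<in> range elts\<close>. Pairing and the empty set follow from
  infinity, separation, power set and replacement, and choice is inherited from HOL.
  Since replacement holds for all HOL functions, the cardinal comparisons \<open><o\<close>, \<open>\<le>o\<close>, \<open>=o\<close>
  of HOL agree on sets with those of the universe.
\<close>

class zfc_universe =
  fixes elts :: "'a \<Rightarrow> 'a set"
  assumes extensionality: "elts x = elts y \<Longrightarrow> x = y"
    and foundation: "wf {(x, y). x \<in> elts y}"
    and separation: "Y \<subseteq> elts x \<Longrightarrow> \<exists>y. elts y = Y"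
    and union: "\<exists>u. elts u = (\<Union>y \<in> elts x. elts y)"
    and power_set: "\<exists>p. elts p = {y. elts y \<subseteq> elts x}"
    and replacement: "\<exists>y. elts y = f ` elts x"
    and infinity: "\<exists>x. infinite (elts x)"

text \<open>Only meaningful if \<open>X \<in> range elts\<close>.\<close>
definition vset :: "'v::zfc_universe set \<Rightarrow> 'v" where
  "vset X = (THE x. elts x = X)"

definition vpair :: "'v::zfc_universe \<Rightarrow> 'v \<Rightarrow> 'v" where
  "vpair x y = vset {vset {x}, vset {x, y}}"

definition vgraph :: "('v::zfc_universe \<Rightarrow> 'v) \<Rightarrow> 'v set \<Rightarrow> 'v" where
  "vgraph f A = vset {vpair x (f x) | x. x \<in> A}"

definition vgraph2 :: "('v::zfc_universe \<Rightarrow> 'v \<Rightarrow> 'v) \<Rightarrow> 'v set \<Rightarrow> 'v" where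
  "vgraph2 f A = vset {vpair (vpair x y) (f x y) | x y. x \<in> A \<and> y \<in> A}"


text \<open>Von Neumann ordinals and cardinals. The cardinality of a set is that of its collection of
  members, so the cardinal \<open>\<kappa>\<close> is represented in HOL's cardinal arithmetic by \<open>|elts \<kappa>|\<close>.\<close>

definition vtransitive :: "'v::zfc_universe \<Rightarrow> bool" where
  "vtransitive x \<longleftrightarrow> (\<forall>y \<in> elts x. elts y \<subseteq> elts x)"

definition vordinal :: "'v::zfc_universe \<Rightarrow> bool" where
  "vordinal \<alpha> \<longleftrightarrow> vtransitive \<alpha> \<and> (\<forall>\<beta> \<in> elts \<alpha>. vtransitive \<beta>)"

definition vcardinal :: "'v::zfc_universe \<Rightarrow> bool" where
  "vcardinal \<kappa> \<longleftrightarrow> vordinal \<kappa> \<and> (\<forall>\<alpha> \<in> elts \<kappa>. |elts \<alpha>| <o |elts \<kappa>| )"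

definition regular_vcardinal :: "'v::zfc_universe \<Rightarrow> bool" where
  "regular_vcardinal \<kappa> \<longleftrightarrow> vcardinal \<kappa> \<and> infinite (elts \<kappa>) \<and> regularCard |elts \<kappa>|"

definition uncountable_vcardinal :: "'v::zfc_universe \<Rightarrow> bool" where
  "uncountable_vcardinal \<kappa> \<longleftrightarrow> vcardinal \<kappa> \<and> natLeq <o |elts \<kappa>|"


definition trans_closure :: "'v::zfc_universe \<Rightarrow> 'v set" where
  "trans_closure x = {y. (y, x) \<in> {(u, v). u \<in> elts v}\<^sup>+}"

definition H :: "'v::zfc_universe \<Rightarrow> 'v set" where
  "H \<theta> = {x. |trans_closure x| <o |elts \<theta>| }"


text \<open>First-order formulas of the language of set theory, with variables \<open>v\<^sub>0, v\<^sub>1, \<dots>\<close>.\<close>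

datatype fm =
    Mem nat nat
  | Eq nat nat
  | Neg fm
  | Conj fm fm
  | Ex nat fm

primrec sat :: "'v::zfc_universe set \<Rightarrow> (nat \<Rightarrow> 'v) \<Rightarrow> fm \<Rightarrow> bool" where
  "sat D e (Mem i j) \<longleftrightarrow> e i \<in> elts (e j)"
| "sat D e (Eq i j) \<longleftrightarrow> e i = e j"
| "sat D e (Neg \<phi>) \<longleftrightarrow> \<not> sat D e \<phi>"
| "sat D e (Conj \<phi> \<psi>) \<longleftrightarrow> sat D e \<phi> \<and> sat D e \<psi>"
| "sat D e (Ex i \<phi>) \<longleftrightarrow> (\<exists>x \<in> D. sat D (e(i := x)) \<phi>)"

definition elementary_submodel :: "'v::zfc_universe set \<Rightarrow> 'v set \<Rightarrow> bool" where
  "elementary_submodel M N \<longleftrightarrow> M \<noteq> {} \<and> M \<subseteq> N \<and>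
     (\<forall>\<phi> e. range e \<subseteq> M \<longrightarrow> (sat M e \<phi> \<longleftrightarrow> sat N e \<phi>))"

definition initial_segment :: "'v::zfc_universe set \<Rightarrow> 'v \<Rightarrow> bool" where
  "initial_segment I \<kappa> \<longleftrightarrow> I \<subseteq> elts \<kappa> \<and>
     (\<forall>\<alpha> \<in> I. \<forall>\<beta> \<in> elts \<kappa>. \<beta> \<in> elts \<alpha> \<longrightarrow> \<beta> \<in> I)"

definition stable :: "'v::zfc_universe \<Rightarrow> 'v set \<Rightarrow> bool" where
  "stable \<kappa> M \<longleftrightarrow> \<kappa> \<in> M \<and> initial_segment (elts \<kappa> \<inter> M) \<kappa>"


record 'a bool_alg =
  carrier :: "'a set"
  meet :: "'a \<Rightarrow> 'a \<Rightarrow> 'a"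
  join :: "'a \<Rightarrow> 'a \<Rightarrow> 'a"
  compl :: "'a \<Rightarrow> 'a"
  zero :: 'a
  one :: 'a

text \<open>The axioms of \<^locale>\<open>abstract_boolean_algebra\<close>, relativised to a carrier. As there, the
  one-element algebra is allowed.\<close>

locale boolean_algebra_on =
  fixes B :: "'a bool_alg"
  assumes meet_closed: "\<lbrakk>x \<in> carrier B; y \<in> carrier B\<rbrakk> \<Longrightarrow> meet B x y \<in> carrier B"
    and join_closed: "\<lbrakk>x \<in> carrier B; y \<in> carrier B\<rbrakk> \<Longrightarrow> join B x y \<in> carrier B"
    and compl_closed: "x \<in> carrier B \<Longrightarrow> compl B x \<in> carrier B"
    and zero_closed: "zero B \<in> carrier B"
    and one_closed: "one B \<in> carrier B"
    and meet_assoc: "\<lbrakk>x \<in> carrier B; y \<in> carrier B; z \<in> carrier B\<rbrakk>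
          \<Longrightarrow> meet B (meet B x y) z = meet B x (meet B y z)"
    and join_assoc: "\<lbrakk>x \<in> carrier B; y \<in> carrier B; z \<in> carrier B\<rbrakk>
          \<Longrightarrow> join B (join B x y) z = join B x (join B y z)"
    and meet_commute: "\<lbrakk>x \<in> carrier B; y \<in> carrier B\<rbrakk> \<Longrightarrow> meet B x y = meet B y x"
    and join_commute: "\<lbrakk>x \<in> carrier B; y \<in> carrier B\<rbrakk> \<Longrightarrow> join B x y = join B y x"
    and meet_join_distrib: "\<lbrakk>x \<in> carrier B; y \<in> carrier B; z \<in> carrier B\<rbrakk>
          \<Longrightarrow> meet B x (join B y z) = join B (meet B x y) (meet B x z)"
    and join_meet_distrib: "\<lbrakk>x \<in> carrier B; y \<in> carrier B; z \<in> carrier B\<rbrakk>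
          \<Longrightarrow> join B x (meet B y z) = meet B (join B x y) (join B x z)"
    and meet_one: "x \<in> carrier B \<Longrightarrow> meet B x (one B) = x"
    and join_zero: "x \<in> carrier B \<Longrightarrow> join B x (zero B) = x"
    and meet_compl: "x \<in> carrier B \<Longrightarrow> meet B x (compl B x) = zero B"
    and join_compl: "x \<in> carrier B \<Longrightarrow> join B x (compl B x) = one B"

definition proper_filter :: "'a bool_alg \<Rightarrow> 'a set \<Rightarrow> bool" where
  "proper_filter B p \<longleftrightarrow> p \<subseteq> carrier B \<and> one B \<in> p \<and> zero B \<notin> p \<and>
     (\<forall>x \<in> p. \<forall>y \<in> p. meet B x y \<in> p) \<and>
     (\<forall>x \<in> p. \<forall>y \<in> carrier B. meet B x y = x \<longrightarrow> y \<in> p)"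

definition Ult :: "'a bool_alg \<Rightarrow> 'a set set" where
  "Ult B = {p. proper_filter B p \<and> (\<forall>q. proper_filter B q \<and> p \<subseteq> q \<longrightarrow> q = p)}"

inductive_set generated :: "'a bool_alg \<Rightarrow> 'a set \<Rightarrow> 'a set"
  for B :: "'a bool_alg" and G :: "'a set" where
  base: "x \<in> G \<Longrightarrow> x \<in> generated B G"
| zero: "zero B \<in> generated B G"
| one: "one B \<in> generated B G"
| meet: "\<lbrakk>x \<in> generated B G; y \<in> generated B G\<rbrakk> \<Longrightarrow> meet B x y \<in> generated B G"
| join: "\<lbrakk>x \<in> generated B G; y \<in> generated B G\<rbrakk> \<Longrightarrow> join B x y \<in> generated B G"
| compl: "x \<in> generated B G \<Longrightarrow> compl B x \<in> generated B G"


text \<open>A Boolean algebra whose carrier is a set of the universe is itself an element of the universe: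
  the tuple of its carrier, the graphs of its operations, and its constants. It depends on the
  operations only through their restrictions to the carrier.\<close>

definition code :: "'v::zfc_universe bool_alg \<Rightarrow> 'v" where
  "code B = vpair (vset (carrier B))
     (vpair (vgraph2 (meet B) (carrier B))
     (vpair (vgraph2 (join B) (carrier B))
     (vpair (vgraph (compl B) (carrier B))
     (vpair (zero B) (one B)))))"

definition is_boolean_algebra :: "'v::zfc_universe bool_alg \<Rightarrow> bool" where
  "is_boolean_algebra B \<longleftrightarrow> boolean_algebra_on B \<and> carrier B \<in> range elts"

definition Corson :: "'v::zfc_universe \<Rightarrow> 'v bool_alg \<Rightarrow> bool" where
  "Corson \<kappa> B \<longleftrightarrow> (\<exists>G \<subseteq> carrier B. generated B G = carrier B \<and>
     (\<forall>p \<in> Ult B. |G \<inter> p| <o |elts \<kappa>| ))"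

text \<open>\<open>Ult B\<close> consists of collections of elements of the universe, \<open>M\<close> of elements of the universe;
  \<open>Ult(B) \<inter> M\<close> is thus \<open>{p \<in> Ult B. vset p \<in> M}\<close>.\<close>

definition good :: "'v::zfc_universe bool_alg \<Rightarrow> 'v set \<Rightarrow> bool" where
  "good B M \<longleftrightarrow> (\<forall>p \<in> Ult B. \<forall>q \<in> Ult B.
     p \<noteq> q \<and> p \<union> q \<subseteq> \<Union>{r \<in> Ult B. vset r \<in> M} \<longrightarrow> p \<inter> M \<noteq> q \<inter> M)"

definition property_B :: "'v::zfc_universe \<Rightarrow> 'v bool_alg \<Rightarrow> bool" where
  "property_B \<kappa> B \<longleftrightarrow> (\<exists>\<mu>. vcardinal \<mu> \<and>
     (\<forall>\<theta>. regular_vcardinal \<theta> \<and> elts \<mu> \<subseteq> elts \<theta> \<longrightarrow>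
       (\<forall>M. elementary_submodel M (H \<theta>) \<and> stable \<kappa> M \<and> code B \<in> M \<and> |M| <o |elts \<kappa>|
          \<longrightarrow> good B M)))"

end

theory Submission
  imports Defs "HOL.Hull" "HOL-Library.Countable"
begin

text \<open>
  If \<open>G\<close> witnesses that \<open>B\<close> is \<open>\<kappa>\<close>-Corson, elementarity gives such a \<open>G\<close> in \<open>M\<close>. For an ultrafilter
  \<open>r \<in> M\<close> the set \<open>G \<inter> r\<close> is enumerated in \<open>M\<close> by an ordinal below \<open>\<kappa>\<close>, so \<open>G \<inter> r \<subseteq> M\<close> by stability.
  Hence \<open>G \<inter> p \<subseteq> M\<close> for every \<open>p \<subseteq> \<Union>(Ult(B) \<inter> M)\<close>, and \<open>p \<inter> M\<close> determines \<open>p\<close>.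

  Conversely, with Skolem functions Property B says that there is a family \<open>\<Phi>\<close> of operations whose closed
  sets of size \<open><\<kappa>\<close> are good. Intersecting a closed set \<open>M\<close> of arbitrary size with suitable small closed
  sets and using compactness of the Stone space, one sees that \<open>M\<close> is good as well and that the closure
  of \<open>Ult(B) \<inter> M\<close> is \<open>\<kappa>\<close>-tight over it. Goodness of \<open>M\<close> yields a retraction of \<open>Ult(B)\<close> onto that
  closure, and dually \<open>\<rho>\<^sub>M : B \<rightarrow> B \<inter> M\<close>. By induction on \<open>|M|\<close>, write \<open>M\<close> as the union of a continuous chain of
  smaller closed sets \<open>M\<^sub>\<alpha>\<close>, take generators \<open>G\<^sub>\<alpha>\<close> of \<open>B \<inter> M\<^sub>\<alpha>\<^sub>+\<^sub>1\<close> and let \<open>G\<close> consist of the differences of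
  \<open>b\<close> and \<open>\<rho>\<^sub>\<alpha> b\<close> for \<open>b \<in> G\<^sub>\<alpha>\<close>. An ultrafilter \<open>p\<close> meets the \<open>\<alpha>\<close>-th part only if its retracts to
  levels \<open>\<alpha>\<close> and \<open>\<alpha> + 1\<close> differ; by tightness this happens for fewer than \<open>\<kappa>\<close> many \<open>\<alpha>\<close>.
\<close>

section \<open>Boolean algebras and ultrafilters\<close>

context boolean_algebra_on
begin

lemma meet_idem: "x \<in> carrier B \<Longrightarrow> meet B x x = x"
  by (metis compl_closed join_compl join_zero meet_closed meet_compl meet_join_distrib meet_one)

lemma meet_zero: "x \<in> carrier B \<Longrightarrow> meet B x (zero B) = zero B"
  by (metis compl_closed meet_assoc meet_compl meet_idem)

lemma meet_join_absorb:
  "\<lbrakk>x \<in> carrier B; y \<in> carrier B\<rbrakk> \<Longrightarrow> meet B x (join B x y) = x"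
  by (metis join_commute join_meet_distrib join_zero meet_commute meet_zero zero_closed)

lemma meet_absorb_left:
  "\<lbrakk>x \<in> carrier B; y \<in> carrier B\<rbrakk> \<Longrightarrow> meet B (meet B x y) x = meet B x y"
  by (metis meet_assoc meet_closed meet_commute meet_idem)

lemma le_if_meet_compl_zero:
  assumes "x \<in> carrier B" "y \<in> carrier B" "meet B x (compl B y) = zero B"
  shows "meet B x y = x"
  using assms
  by (metis compl_closed join_compl join_zero meet_closed meet_join_distrib meet_one)

text \<open>The filter generated by \<open>p\<close> and \<open>x\<close>: its elements lie above
  some \<open>meet B a x\<close> with \<open>a \<in> p\<close>, so \<open>nz\<close> keeps zero
  out.\<close>

lemma proper_filter_generated:
  assumes p: "proper_filter B p" and x: "x \<in> carrier B"
    and nz: "\<And>a. a \<in> p \<Longrightarrow> meet B a x \<noteq> zero B"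
  shows "proper_filter B {y \<in> carrier B. \<exists>a\<in>p. meet B (meet B a x) y = meet B a x}"
proof -
  have pC: "\<And>a. a \<in> p \<Longrightarrow> a \<in> carrier B" and p1: "one B \<in> p"
    and pm: "\<And>a b. a \<in> p \<Longrightarrow> b \<in> p \<Longrightarrow> meet B a b \<in> p"
    using p by (auto simp: proper_filter_def)
  have meets: "\<exists>c\<in>p. meet B (meet B c x) (meet B y z) = meet B c x"
    if "y \<in> carrier B" "z \<in> carrier B" "a \<in> p" "b \<in> p"
      and y: "meet B (meet B a x) y = meet B a x" and z: "meet B (meet B b x) z = meet B b x"
    for y z a b
  proof (rule bexI[of _ "meet B a b"])
    note cl = that(1,2) pC[OF that(3)] pC[OF that(4)] x
    note ac = meet_assoc meet_closed
    have "meet B (meet B (meet B a b) x) y = meet B b (meet B (meet B a x) y)"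
      using cl by (simp add: ac meet_commute[of a b])
    also have "\<dots> = meet B (meet B a b) x"
      using cl by (simp add: y) (simp add: ac meet_commute[of a b])
    finally have 1: "meet B (meet B (meet B a b) x) y = meet B (meet B a b) x" .
    have "meet B (meet B (meet B a b) x) z = meet B a (meet B (meet B b x) z)"
      using cl by (simp add: ac)
    also have "\<dots> = meet B (meet B a b) x"
      using cl by (simp add: z) (simp add: ac)
    finally have 2: "meet B (meet B (meet B a b) x) z = meet B (meet B a b) x" .
    show "meet B (meet B (meet B a b) x) (meet B y z) = meet B (meet B a b) x"
      using cl 1 2 by (metis meet_assoc meet_closed)
  qed (use that pm in auto)
  have ups: "meet B (meet B a x) z = meet B a x"
    if "y \<in> carrier B" "z \<in> carrier B" "a \<in> p" "meet B (meet B a x) y = meet B a x" "meet B y z = y"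
    for y z a
    using that x pC by (metis meet_assoc meet_closed)
  show ?thesis (is "proper_filter B ?F")
    unfolding proper_filter_def
  proof (intro conjI ballI impI)
    show "one B \<in> ?F"
      using p1 pC x by (auto simp: meet_one meet_closed one_closed)
    show "zero B \<notin> ?F"
      using nz pC x by (fastforce simp: meet_zero meet_closed)
  next
    fix y z assume "y \<in> ?F" "z \<in> ?F"
    then show "meet B y z \<in> ?F"
      using meets by (auto simp: meet_closed)
  next
    fix y z assume "y \<in> ?F" "z \<in> carrier B" "meet B y z = y"
    then show "z \<in> ?F"
      using ups by blast
  qed auto
qed

lemma UltD: "p \<in> Ult B \<Longrightarrow> proper_filter B p"
  by (simp add: Ult_def)

lemma Ult_carrier: "p \<in> Ult B \<Longrightarrow> x \<in> p \<Longrightarrow> x \<in> carrier B"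
  by (auto simp: Ult_def proper_filter_def)

lemma one_in_Ult: "p \<in> Ult B \<Longrightarrow> one B \<in> p"
  and zero_notin_Ult: "p \<in> Ult B \<Longrightarrow> zero B \<notin> p"
  by (auto simp: Ult_def proper_filter_def)

lemma meet_in_Ult:
  assumes "p \<in> Ult B" "x \<in> carrier B" "y \<in> carrier B"
  shows "meet B x y \<in> p \<longleftrightarrow> x \<in> p \<and> y \<in> p"
proof
  assume xy: "meet B x y \<in> p"
  have up: "z \<in> p" if "z \<in> carrier B" "meet B (meet B x y) z = meet B x y" for z
    using UltD[OF assms(1)] xy that by (auto simp: proper_filter_def)
  have "meet B (meet B x y) y = meet B x y"
    using assms by (metis meet_assoc meet_idem)
  then show "x \<in> p \<and> y \<in> p"
    using up[of x] up[of y] assms meet_absorb_left[of x y] by auto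
next
  assume "x \<in> p \<and> y \<in> p"
  then show "meet B x y \<in> p"
    using UltD[OF assms(1)] by (auto simp: proper_filter_def)
qed

lemma Ult_upward:
  assumes "p \<in> Ult B" "x \<in> p" "y \<in> carrier B" "meet B x y = x"
  shows "y \<in> p"
  using assms UltD[of p] by (auto simp: proper_filter_def)

text \<open>If \<open>x\<close> is not in \<open>p\<close>, no \<open>a \<in> p\<close> is disjoint
  from \<open>compl B x\<close>, since such an \<open>a\<close> would lie below \<open>x\<close>. So
  \<open>p\<close> and \<open>compl B x\<close> generate a proper filter, which equals
  \<open>p\<close> by maximality.\<close>

lemma compl_in_Ult:
  assumes p: "p \<in> Ult B" and x: "x \<in> carrier B"
  shows "compl B x \<in> p \<longleftrightarrow> x \<notin> p"
proof
  assume "compl B x \<in> p"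
  then show "x \<notin> p"
    using meet_in_Ult[OF p x compl_closed[OF x]] zero_notin_Ult[OF p] meet_compl[OF x] by auto
next
  assume xp: "x \<notin> p"
  let ?q = "{y \<in> carrier B. \<exists>a\<in>p. meet B (meet B a (compl B x)) y = meet B a (compl B x)}"
  have "meet B a (compl B x) \<noteq> zero B" if "a \<in> p" for a
    using le_if_meet_compl_zero[OF Ult_carrier[OF p that] x] Ult_upward[OF p that x] xp by auto
  then have "proper_filter B ?q"
    by (rule proper_filter_generated[OF UltD[OF p] compl_closed[OF x]])
  moreover have "p \<subseteq> ?q"
    using Ult_carrier[OF p] meet_absorb_left compl_closed[OF x] by blast
  ultimately have "?q = p"
    using p by (auto simp: Ult_def)
  moreover have "compl B x \<in> ?q"
    using x by (auto intro!: bexI[of _ "one B"] simp: one_in_Ult[OF p] compl_closed meet_idem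
        meet_closed one_closed meet_assoc)
  ultimately show "compl B x \<in> p" by simp
qed

lemma join_in_Ult:
  assumes p: "p \<in> Ult B" and x: "x \<in> carrier B" and y: "y \<in> carrier B"
  shows "join B x y \<in> p \<longleftrightarrow> x \<in> p \<or> y \<in> p"
proof
  assume "x \<in> p \<or> y \<in> p"
  then show "join B x y \<in> p"
    using Ult_upward[OF p _ join_closed[OF x y]] meet_join_absorb[OF x y]
      meet_join_absorb[OF y x] join_commute[OF x y] by metis
next
  assume j: "join B x y \<in> p"
  show "x \<in> p \<or> y \<in> p"
  proof (rule ccontr)
    assume "\<not> (x \<in> p \<or> y \<in> p)"
    then have "meet B (compl B x) (compl B y) \<in> p"
      using p x y by (simp add: meet_in_Ult compl_in_Ult compl_closed)
    then have "meet B (meet B (compl B x) (compl B y)) (join B x y) \<in> p"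
      using j p x y by (simp add: meet_in_Ult compl_closed meet_closed join_closed)
    moreover have "meet B (meet B (compl B x) (compl B y)) (join B x y) = zero B"
    proof -
      let ?c = "meet B (compl B x) (compl B y)"
      have "meet B ?c x = zero B"
        using x y by (metis compl_closed meet_assoc meet_commute meet_compl meet_zero)
      moreover have "meet B ?c y = zero B"
        using x y by (metis compl_closed meet_assoc meet_commute meet_compl meet_zero)
      ultimately show ?thesis
        using x y by (simp add: meet_join_distrib compl_closed meet_closed join_zero zero_closed)
    qed
    ultimately show False
      using zero_notin_Ult[OF p] by simp
  qed
qed

lemma Ult_eqI:
  assumes p: "p \<in> Ult B" and q: "q \<in> Ult B" and pq: "p \<subseteq> q"
  shows "p = q"
  using p pq UltD[OF q] by (auto simp: Ult_def)

section \<open>Existence of ultrafilters, Stone duality and compactness\<close>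

lemma proper_filter_extend:
  assumes F: "proper_filter B F"
  shows "\<exists>p\<in>Ult B. F \<subseteq> p"
proof -
  let ?A = "{q. proper_filter B q \<and> F \<subseteq> q}"
  have "\<exists>m\<in>?A. \<forall>q\<in>?A. m \<subseteq> q \<longrightarrow> q = m"
  proof (rule subset_Zorn_nonempty)
    show "?A \<noteq> {}" using F by auto
    fix C assume ne: "C \<noteq> {}" and C: "subset.chain ?A C"
    have sub: "C \<subseteq> ?A" and lin: "\<And>a b. a \<in> C \<Longrightarrow> b \<in> C \<Longrightarrow> a \<subseteq> b \<or> b \<subseteq> a"
      using C unfolding subset.chain_def by blast+
    have meets: "meet B x y \<in> \<Union>C" if xy: "x \<in> \<Union>C" "y \<in> \<Union>C" for x y
    proof -
      obtain a b where ab: "a \<in> C" "b \<in> C" "x \<in> a" "y \<in> b" using xy by auto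
      then obtain c where "c \<in> C" "x \<in> c" "y \<in> c" using lin[of a b] by blast
      moreover have "proper_filter B c" using \<open>c \<in> C\<close> sub by auto
      ultimately show ?thesis by (auto simp: proper_filter_def intro!: bexI[of _ c])
    qed
    have "proper_filter B (\<Union>C)"
      unfolding proper_filter_def
    proof (intro conjI ballI impI)
      show "one B \<in> \<Union>C" "zero B \<notin> \<Union>C" "\<Union>C \<subseteq> carrier B"
        using sub ne by (auto simp: proper_filter_def)
    next
      fix x y assume "x \<in> \<Union>C" "y \<in> carrier B" "meet B x y = x"
      then obtain c where c: "c \<in> C" "x \<in> c" and "proper_filter B c" using sub by auto
      then have "y \<in> c"
        using \<open>y \<in> carrier B\<close> \<open>meet B x y = x\<close> by (auto simp: proper_filter_def)
      then show "y \<in> \<Union>C" using c(1) by auto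
    qed (rule meets)
    then show "\<Union>C \<in> ?A"
      using sub ne by auto
  qed
  then obtain m where m: "m \<in> ?A" "\<forall>q\<in>?A. m \<subseteq> q \<longrightarrow> q = m" ..
  then have "m \<in> Ult B" unfolding Ult_def by (smt (verit) mem_Collect_eq order_trans)
  moreover have "F \<subseteq> m" using m(1) by simp
  ultimately show ?thesis by blast
qed

lemma nonzero_in_Ult:
  assumes x: "x \<in> carrier B" "x \<noteq> zero B"
  shows "\<exists>p\<in>Ult B. x \<in> p"
proof -
  have "proper_filter B {y \<in> carrier B. meet B x y = x}"
    unfolding proper_filter_def
  proof (intro conjI ballI impI)
    fix a b assume "a \<in> {y \<in> carrier B. meet B x y = x}" "b \<in> {y \<in> carrier B. meet B x y = x}"
    then show "meet B a b \<in> {y \<in> carrier B. meet B x y = x}"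
      using x by (auto simp: meet_closed meet_assoc[symmetric])
  next
    fix a b assume "a \<in> {y \<in> carrier B. meet B x y = x}" "b \<in> carrier B" "meet B a b = a"
    then show "b \<in> {y \<in> carrier B. meet B x y = x}"
      using x by (auto) (metis meet_assoc)
  qed (use x in \<open>auto simp: meet_one one_closed meet_zero\<close>)
  from proper_filter_extend[OF this] show ?thesis
    using x meet_idem by auto
qed

text \<open>Both differences of \<open>x\<close> and \<open>y\<close> lie in no ultrafilter, hence
  are zero. Later Boolean identities are checked ultrafilter by ultrafilter in this way.\<close>

lemma eq_if_same_Ult:
  assumes x: "x \<in> carrier B" and y: "y \<in> carrier B"
    and eq: "\<And>p. p \<in> Ult B \<Longrightarrow> x \<in> p \<longleftrightarrow> y \<in> p"
  shows "x = y"
proof -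
  have "meet B a (compl B b) = zero B"
    if ab: "a \<in> carrier B" "b \<in> carrier B" and
      same: "\<And>p. p \<in> Ult B \<Longrightarrow> a \<in> p \<longleftrightarrow> b \<in> p" for a b
  proof (rule ccontr)
    assume "meet B a (compl B b) \<noteq> zero B"
    then obtain p where "p \<in> Ult B" "meet B a (compl B b) \<in> p"
      using nonzero_in_Ult[of "meet B a (compl B b)"] ab meet_closed compl_closed by blast
    then show False
      using ab same by (auto simp: meet_in_Ult compl_in_Ult compl_closed)
  qed
  from this[OF x y eq] this[OF y x eq[symmetric]] show ?thesis
    using le_if_meet_compl_zero[OF x y] le_if_meet_compl_zero[OF y x] meet_commute[OF x y] by auto
qed

text \<open>Compactness of the Stone space: \<open>p \<subseteq> \<Union>R\<close> says that \<open>p\<close> lies in the closure of \<open>R\<close>.\<close>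

lemma Ult_compactness:
  assumes A: "A \<subseteq> carrier B" "A \<noteq> {}" "\<And>a b. a \<in> A \<Longrightarrow> b \<in> A \<Longrightarrow> meet B a b \<in> A"
    and R: "R \<subseteq> Ult B" "A \<subseteq> \<Union>R"
  shows "\<exists>p\<in>Ult B. A \<subseteq> p \<and> p \<subseteq> \<Union>R"
proof -
  \<comment> \<open>\<open>?F\<close> collects the elements that lie above some
    \<open>a \<in> A\<close> as far as the ultrafilters in \<open>R\<close> can tell. It is proper
    because every \<open>a\<close> belongs to some \<open>r \<in> R\<close>.\<close>
  let ?F = "{x \<in> carrier B. \<exists>a\<in>A. \<forall>r\<in>R. a \<in> r \<longrightarrow> x \<in> r}"
  have "proper_filter B ?F"
    unfolding proper_filter_def
  proof (intro conjI ballI impI)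
    show "one B \<in> ?F" using A(2) R(1) one_closed one_in_Ult by blast
    show "zero B \<notin> ?F"
    proof
      assume "zero B \<in> ?F"
      then obtain a where a: "a \<in> A" "\<forall>r\<in>R. a \<in> r \<longrightarrow> zero B \<in> r" by auto
      then obtain r where "r \<in> R" "a \<in> r" using R(2) by auto
      then show False using a(2) R(1) zero_notin_Ult by auto
    qed
  next
    fix x y assume "x \<in> ?F" "y \<in> ?F"
    then obtain a b where ab: "x \<in> carrier B" "y \<in> carrier B" "a \<in> A" "b \<in> A"
      "\<forall>r\<in>R. a \<in> r \<longrightarrow> x \<in> r" "\<forall>r\<in>R. b \<in> r \<longrightarrow> y \<in> r" by auto
    then have "\<forall>r\<in>R. meet B a b \<in> r \<longrightarrow> meet B x y \<in> r"
      using R(1) A(1) by (auto simp: meet_in_Ult subset_iff)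
    then show "meet B x y \<in> ?F"
      using ab A(3) by (auto simp: meet_closed)
  next
    fix x y assume "x \<in> ?F" and y: "y \<in> carrier B" "meet B x y = x"
    then obtain a where "a \<in> A" "\<forall>r\<in>R. a \<in> r \<longrightarrow> x \<in> r" by auto
    moreover from this have "\<forall>r\<in>R. a \<in> r \<longrightarrow> y \<in> r"
      using R(1) Ult_upward[OF _ _ y] by auto
    ultimately show "y \<in> ?F" using y(1) by auto
  qed auto
  then obtain p where p: "p \<in> Ult B" "?F \<subseteq> p" using proper_filter_extend by blast
  \<comment> \<open>An element missed by all of \<open>R\<close> has its complement in
    \<open>?F\<close>, hence in \<open>p\<close>; so \<open>p\<close> stays in the closure of
    \<open>R\<close>.\<close>
  have "x \<in> \<Union>R" if "x \<in> p" for x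
  proof (rule ccontr)
    assume "x \<notin> \<Union>R"
    then have "\<forall>r\<in>R. compl B x \<in> r"
      using R(1) compl_in_Ult Ult_carrier[OF p(1) that] by blast
    then have "compl B x \<in> ?F"
      using A(2) compl_closed[OF Ult_carrier[OF p(1) that]] by blast
    then show False
      using p that Ult_carrier[OF p(1) that] compl_in_Ult[OF p(1)] by auto
  qed
  then have "p \<subseteq> \<Union>R" by (rule subsetI)
  moreover have "A \<subseteq> ?F" using A(1) by auto
  ultimately show ?thesis using p by (meson order_trans)
qed

lemma generated_subset_carrier: "G \<subseteq> carrier B \<Longrightarrow> generated B G \<subseteq> carrier B"
proof
  fix x assume "x \<in> generated B G" "G \<subseteq> carrier B"
  then show "x \<in> carrier B"
    by induction (auto simp: zero_closed one_closed meet_closed join_closed compl_closed)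
qed

text \<open>Whether an ultrafilter contains a meet, join or complement is decided by the arguments,
  so agreement on \<open>G\<close> spreads to all generated elements.\<close>

lemma generated_separates:
  assumes G: "G \<subseteq> carrier B" "generated B G = carrier B"
    and p: "p \<in> Ult B" and q: "q \<in> Ult B" and eq: "G \<inter> p = G \<inter> q"
  shows "p = q"
proof -
  have "x \<in> p \<longleftrightarrow> x \<in> q" if "x \<in> generated B G" for x
    using that
  proof induction
    case (base x)
    then show ?case using eq by auto
  qed (use generated_subset_carrier[OF G(1)] p q in
      \<open>auto simp: zero_notin_Ult one_in_Ult meet_in_Ult join_in_Ult compl_in_Ult subset_iff\<close>)
  then show ?thesis
    using Ult_carrier[OF p] Ult_carrier[OF q] G(2) by blast
qed

end

lemma generated_mono: "G \<subseteq> generated B G' \<Longrightarrow> generated B G \<subseteq> generated B G'"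
proof
  fix x assume "x \<in> generated B G" "G \<subseteq> generated B G'"
  then show "x \<in> generated B G'"
    by induction (auto intro: generated.intros)
qed

section \<open>Small sets and closure under set-valued operations\<close>

text \<open>Set values on finite lists let one \<open>\<Phi>\<close> bundle constants, Skolem
  functions of every arity, and the passage from an ordinal to its members.\<close>

definition op_closed :: "('a list \<Rightarrow> 'a set) \<Rightarrow> 'a set \<Rightarrow> bool" where
  "op_closed \<Phi> M \<longleftrightarrow> (\<forall>xs. set xs \<subseteq> M \<longrightarrow> \<Phi> xs \<subseteq> M)"

lemma op_closedD: "op_closed \<Phi> M \<Longrightarrow> set xs \<subseteq> M \<Longrightarrow> \<Phi> xs \<subseteq> M"
  by (simp add: op_closed_def)

lemma op_closed_Int: "op_closed \<Phi> M \<Longrightarrow> op_closed \<Phi> N \<Longrightarrow> op_closed \<Phi> (M \<inter> N)"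
  by (auto simp: op_closed_def)

lemma op_closed_hull: "op_closed \<Phi> (op_closed \<Phi> hull X)"
  by (rule hull_in) (auto simp: op_closed_def)

text \<open>A finite list of arguments from a union of a chain already lies in one member of the
  chain.\<close>

lemma op_closed_Union_chain:
  assumes ne: "\<C> \<noteq> {}" and cl: "\<And>M. M \<in> \<C> \<Longrightarrow> op_closed \<Phi> M"
    and chain: "\<And>M N. M \<in> \<C> \<Longrightarrow> N \<in> \<C> \<Longrightarrow> M \<subseteq> N \<or> N \<subseteq> M"
  shows "op_closed \<Phi> (\<Union>\<C>)"
proof -
  have "\<exists>M\<in>\<C>. set xs \<subseteq> M" if "set xs \<subseteq> \<Union>\<C>" for xs :: "'a list"
    using that
  proof (induction xs)
    case Nil
    then show ?case using ne by auto
  next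
    case (Cons x xs)
    then obtain M N where "M \<in> \<C>" "set xs \<subseteq> M" "N \<in> \<C>" "x \<in> N" by auto
    then show ?case
      using chain[of M N] by auto
  qed
  then show ?thesis
    using cl unfolding op_closed_def by (meson Union_upper order_trans)
qed

primrec op_stage :: "('a list \<Rightarrow> 'a set) \<Rightarrow> 'a set \<Rightarrow> nat \<Rightarrow> 'a set" where
  "op_stage \<Phi> X 0 = X"
| "op_stage \<Phi> X (Suc n) = op_stage \<Phi> X n \<union> (\<Union>xs\<in>lists (op_stage \<Phi> X n). \<Phi> xs)"

text \<open>Finite lists of arguments appear at some finite stage, so countably many stages suffice.
  This is the source of the cardinality bounds on hulls.\<close>

lemma hull_subset_op_stages: "op_closed \<Phi> hull X \<subseteq> (\<Union>n. op_stage \<Phi> X n)"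
proof (rule hull_minimal)
  show "X \<subseteq> (\<Union>n. op_stage \<Phi> X n)"
    using op_stage.simps(1)[of \<Phi> X] by blast
  have mono: "op_stage \<Phi> X m \<subseteq> op_stage \<Phi> X n" if "m \<le> n" for m n
    using that by (induction rule: dec_induct) auto
  have "\<exists>n. set xs \<subseteq> op_stage \<Phi> X n" if "set xs \<subseteq> (\<Union>n. op_stage \<Phi> X n)" for xs
    using that
  proof (induction xs)
    case (Cons x xs)
    then obtain m n where "set xs \<subseteq> op_stage \<Phi> X m" "x \<in> op_stage \<Phi> X n" by auto
    then have "set (x # xs) \<subseteq> op_stage \<Phi> X (max m n)"
      using mono[of m "max m n"] mono[of n "max m n"] by auto
    then show ?case by blast
  qed auto
  moreover have "\<Phi> xs \<subseteq> op_stage \<Phi> X (Suc n)" if "set xs \<subseteq> op_stage \<Phi> X n" for xs n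
    using that by (auto simp: lists_eq_set)
  ultimately have "\<Phi> xs \<subseteq> (\<Union>n. op_stage \<Phi> X n)" if "set xs \<subseteq> (\<Union>n. op_stage \<Phi> X n)" for xs
    using that by (meson UN_upper UNIV_I order_trans)
  then show "op_closed \<Phi> (\<Union>n. op_stage \<Phi> X n)"
    by (simp add: op_closed_def)
qed

section \<open>Cardinality bounds below a regular uncountable cardinal\<close>

locale regular_uncountable =
  fixes k :: "'k rel"
  assumes card_k: "Card_order k" and regular_k: "regularCard k" and uncountable_k: "natLeq <o k"
begin

abbreviation small :: "'a set \<Rightarrow> bool" where
  "small A \<equiv> |A| <o k"

lemma Cinfinite_k: "Cinfinite k"
  using card_k uncountable_k natLeq_Cinfinite
  by (meson Cinfinite_cong Cinfinite_limit cinfinite_mono ordLess_imp_ordLeq)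

lemma stable_k: "BNF_Cardinal_Order_Relation.stable k"
  using Cinfinite_k regular_k by (auto intro: regularCard_stable simp: cinfinite_def)

lemma small_UN: "small I \<Longrightarrow> (\<And>i. i \<in> I \<Longrightarrow> small (A i)) \<Longrightarrow> small (\<Union>i\<in>I. A i)"
  by (rule stable_UNION[OF stable_k])

lemma small_subset: "small B \<Longrightarrow> A \<subseteq> B \<Longrightarrow> small A"
  using card_of_mono1 ordLeq_ordLess_trans by blast

lemma small_image: "small A \<Longrightarrow> small (f ` A)"
  using card_of_image ordLeq_ordLess_trans by blast

lemma small_nat: "small (UNIV :: nat set)"
  using uncountable_k card_of_nat ordIso_ordLess_trans by blast

lemma small_finite: "finite A \<Longrightarrow> small A"
  using Cinfinite_k by (auto simp: cinfinite_def intro: finite_ordLess_infinite card_of_Well_order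
      card_order_on_well_order_on simp: Field_card_of)

lemma small_Un:
  assumes "small A" "small B"
  shows "small (A \<union> B)"
proof -
  have "small (\<Union>i\<in>{True, False}. if i then A else B)"
    by (rule small_UN) (use assms in \<open>auto intro: small_finite\<close>)
  then show ?thesis by (simp add: Un_commute)
qed

lemma small_insert: "small A \<Longrightarrow> small (insert x A)"
  using small_Un[OF small_finite[of "{x}"]] by simp

lemma small_lists:
  assumes A: "small A"
  shows "small (lists A)"
proof -
  have "small {xs \<in> lists A. length xs = n}" for n
  proof (induction n)
    case 0
    have "{xs \<in> lists A. length xs = 0} = {[]}" by auto
    then show ?case by (simp add: small_finite)
  next
    case (Suc n)
    have "{xs \<in> lists A. length xs = Suc n} =
      (\<Union>a\<in>A. (\<lambda>xs. a # xs) ` {xs \<in> lists A. length xs = n})"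
      by (force simp: length_Suc_conv)
    then show ?case
      using small_UN[OF A small_image[OF Suc]] by simp
  qed
  then have "small (\<Union>n::nat. {xs \<in> lists A. length xs = n})"
    by (intro small_UN small_nat)
  moreover have "(\<Union>n. {xs \<in> lists A. length xs = n}) = lists A" by auto
  ultimately show ?thesis by simp
qed

text \<open>By regularity each stage stays small; since \<open>k\<close> is uncountable, so does the
  union of the countably many stages.\<close>

lemma small_hull:
  assumes \<Phi>: "\<And>xs. small (\<Phi> xs)" and X: "small X"
  shows "small (op_closed \<Phi> hull X)"
proof -
  have "small (op_stage \<Phi> X n)" for n
  proof (induction n)
    case (Suc n)
    then show ?case
      using small_Un[OF Suc small_UN[OF small_lists[OF Suc] \<Phi>]] by simp
  qed (simp add: X)
  then have "small (\<Union>n. op_stage \<Phi> X n)"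
    by (intro small_UN small_nat)
  then show ?thesis
    by (rule small_subset[OF _ hull_subset_op_stages])
qed

text \<open>\<open>|Y|\<close> may be singular, so \<open>small_hull\<close> is not applied at
  \<open>|Y|\<close> itself. If \<open>X\<close> is not small, it is applied at the successor of
  \<open>|X|\<close>, which is regular, and yields a hull no larger than \<open>X\<close>.\<close>

lemma hull_ordLess:
  assumes \<Phi>: "\<And>xs. small (\<Phi> xs)" and X: "|X| <o |Y|" and Y: "k \<le>o |Y|"
  shows "|op_closed \<Phi> hull X| <o |Y|"
proof (cases "small X")
  case True
  from small_hull[of \<Phi>, OF \<Phi> this] show ?thesis
    using Y by (rule ordLess_ordLeq_trans)
next
  case False
  then have kX: "k \<le>o |X|"
    using ordLess_or_ordLeq[OF card_of_Well_order card_order_on_well_order_on[OF card_k]] by auto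
  then have X': "Cinfinite |X|"
    using Cinfinite_k card_of_Card_order cinfinite_mono by blast
  interpret suc: regular_uncountable "cardSuc |X|"
  proof
    show "Card_order (cardSuc |X| )" by (simp add: cardSuc_Card_order card_of_Card_order)
    show "regularCard (cardSuc |X| )" using X' by (rule regularCard_cardSuc)
    show "natLeq <o cardSuc |X|"
      using uncountable_k kX cardSuc_greater[OF card_of_Card_order[of X]]
      by (meson ordLess_ordLeq_trans ordLess_transitive)
  qed
  have "|\<Phi> xs| <o cardSuc |X|" for xs
    using \<Phi>[of xs] kX cardSuc_greater[OF card_of_Card_order[of X]]
    by (meson ordLess_ordLeq_trans ordLess_transitive)
  then have "|op_closed \<Phi> hull X| <o cardSuc |X|"
    by (rule suc.small_hull) (rule cardSuc_greater[OF card_of_Card_order])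
  then have "|op_closed \<Phi> hull X| \<le>o |X|"
    by (simp add: cardSuc_ordLeq_ordLess card_of_Card_order)
  then show ?thesis
    using X ordLeq_ordLess_trans by blast
qed

end

section \<open>Reflecting goodness to closed sets of arbitrary size\<close>

text \<open>\<open>named_Ult M\<close> is \<open>Ult(B) \<inter> M\<close>, and \<open>closure_Ult M\<close> is its closure in the Stone space.\<close>

definition named_Ult :: "'v::zfc_universe bool_alg \<Rightarrow> 'v set \<Rightarrow> 'v set set" where
  "named_Ult B M = {r \<in> Ult B. vset r \<in> M}"

definition closure_Ult :: "'v::zfc_universe bool_alg \<Rightarrow> 'v set \<Rightarrow> 'v set set" where
  "closure_Ult B M = {p \<in> Ult B. p \<subseteq> \<Union>(named_Ult B M)}"

lemma named_Ult_mono: "M \<subseteq> N \<Longrightarrow> named_Ult B M \<subseteq> named_Ult B N"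
  by (auto simp: named_Ult_def)

lemma closure_Ult_mono: "M \<subseteq> N \<Longrightarrow> closure_Ult B M \<subseteq> closure_Ult B N"
  using Union_mono[OF named_Ult_mono[of M N B]] by (auto simp: closure_Ult_def)

lemma closure_UltD: "p \<in> closure_Ult B M \<Longrightarrow> p \<in> Ult B"
  by (simp add: closure_Ult_def)

lemma named_in_closure_Ult: "p \<in> Ult B \<Longrightarrow> vset p \<in> M \<Longrightarrow> p \<in> closure_Ult B M"
  by (auto simp: closure_Ult_def named_Ult_def)

lemma good_iff:
  "good B M \<longleftrightarrow> (\<forall>p \<in> closure_Ult B M. \<forall>q \<in> closure_Ult B M. p \<inter> M = q \<inter> M \<longrightarrow> p = q)"
  by (auto simp: good_def closure_Ult_def named_Ult_def)

text \<open>What the converse direction takes from Property B. Submodels become sets closed under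
  \<open>\<Phi>\<close>, and elementarity becomes closure under the Boolean operations and the
  presence of a named ultrafilter through each nonzero element.\<close>

locale good_closure = boolean_algebra_on B + regular_uncountable k
  for B :: "'v::zfc_universe bool_alg" and k :: "'k rel" +
  fixes \<Phi> :: "'v list \<Rightarrow> 'v set"
  assumes small_\<Phi>: "\<And>xs. small (\<Phi> xs)"
    and closed_consts: "op_closed \<Phi> M \<Longrightarrow> zero B \<in> M \<and> one B \<in> M"
    and closed_ops: "\<lbrakk>op_closed \<Phi> M; x \<in> M; y \<in> M; x \<in> carrier B; y \<in> carrier B\<rbrakk>
      \<Longrightarrow> compl B x \<in> M \<and> meet B x y \<in> M \<and> join B x y \<in> M"
    and closed_Ult: "\<lbrakk>op_closed \<Phi> M; x \<in> M; x \<in> carrier B; x \<noteq> zero B\<rbrakk>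
      \<Longrightarrow> x \<in> \<Union>(named_Ult B M)"
    and small_good: "op_closed \<Phi> M \<Longrightarrow> small M \<Longrightarrow> good B M"
begin

lemma trace_eqI:
  assumes M: "op_closed \<Phi> M" and p: "p \<in> Ult B" and q: "q \<in> Ult B" and pq: "p \<inter> M \<subseteq> q"
  shows "q \<inter> M = p \<inter> M"
proof -
  have "x \<in> p" if x: "x \<in> q" "x \<in> M" for x
  proof (rule ccontr)
    assume "x \<notin> p"
    have xC: "x \<in> carrier B" using Ult_carrier[OF q x(1)] .
    then have "compl B x \<in> p \<inter> M"
      using \<open>x \<notin> p\<close> closed_ops[OF M x(2) x(2)] compl_in_Ult[OF p] by auto
    then show False
      using pq x(1) compl_in_Ult[OF q xC] by auto
  qed
  then show ?thesis using pq by auto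
qed

text \<open>The trace \<open>p \<inter> M\<close> is closed under meets, so compactness extends it
  to an ultrafilter in the closure of \<open>R\<close>; closure of \<open>M\<close> under
  complements makes the traces equal.\<close>

lemma exists_same_trace:
  assumes M: "op_closed \<Phi> M" and p: "p \<in> Ult B" and R: "R \<subseteq> Ult B" "p \<inter> M \<subseteq> \<Union>R"
  shows "\<exists>q \<in> Ult B. q \<subseteq> \<Union>R \<and> q \<inter> M = p \<inter> M"
proof -
  have "\<exists>q\<in>Ult B. p \<inter> M \<subseteq> q \<and> q \<subseteq> \<Union>R"
  proof (rule Ult_compactness[OF _ _ _ R])
    show "p \<inter> M \<subseteq> carrier B" using Ult_carrier[OF p] by auto
    show "p \<inter> M \<noteq> {}" using one_in_Ult[OF p] closed_consts[OF M] by auto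
    show "meet B a b \<in> p \<inter> M" if "a \<in> p \<inter> M" "b \<in> p \<inter> M" for a b
      using that closed_ops[OF M, of a b] Ult_carrier[OF p] meet_in_Ult[OF p] by auto
  qed
  then show ?thesis using trace_eqI[OF M p] by blast
qed

text \<open>\<open>q\<close> is the image of \<open>p\<close> under the retraction onto
  \<open>closure_Ult B M\<close>; its uniqueness will be \<open>closure_Ult_eqI\<close>.\<close>

lemma exists_retract:
  assumes M: "op_closed \<Phi> M" and p: "p \<in> Ult B"
  shows "\<exists>q \<in> closure_Ult B M. q \<inter> M = p \<inter> M"
proof -
  have "p \<inter> M \<subseteq> \<Union>(named_Ult B M)"
    using closed_Ult[OF M] Ult_carrier[OF p] zero_notin_Ult[OF p] by blast
  then show ?thesis
    using exists_same_trace[OF M p, of "named_Ult B M"] by (auto simp: closure_Ult_def named_Ult_def)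
qed

text \<open>The choice of a named ultrafilter through \<open>x\<close> is added to the operations as
  \<open>u\<close>. This keeps the hull small and puts the name of the chosen witness into both
  \<open>M\<close> and \<open>N\<close>.\<close>

lemma exists_small_reflecting:
  assumes X: "small X"
  shows "\<exists>N. X \<subseteq> N \<and> op_closed \<Phi> N \<and> small N \<and>
    N \<inter> \<Union>(named_Ult B M) \<subseteq> \<Union>(named_Ult B (M \<inter> N))"
proof -
  define u where "u x = (SOME r. r \<in> named_Ult B M \<and> x \<in> r)" for x
  define \<Psi> where "\<Psi> xs = \<Phi> xs \<union> (vset \<circ> u) ` set xs" for xs
  define N where "N = op_closed \<Psi> hull X"
  have N: "op_closed \<Psi> N" unfolding N_def by (rule op_closed_hull)
  then have "op_closed \<Phi> N" by (auto simp: op_closed_def \<Psi>_def)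
  moreover have "small N"
    unfolding N_def
  proof (rule small_hull[OF _ X])
    show "small (\<Psi> xs)" for xs
      unfolding \<Psi>_def by (intro small_Un small_\<Phi> small_finite) auto
  qed
  moreover have "X \<subseteq> N" unfolding N_def by (rule hull_subset)
  moreover have "x \<in> \<Union>(named_Ult B (M \<inter> N))" if x: "x \<in> N" "x \<in> \<Union>(named_Ult B M)" for x
  proof -
    have "u x \<in> named_Ult B M \<and> x \<in> u x"
      unfolding u_def by (rule someI_ex) (use x in auto)
    moreover have "vset (u x) \<in> N"
      using op_closedD[OF N, of "[x]"] x(1) by (auto simp: \<Psi>_def)
    ultimately show ?thesis by (auto simp: named_Ult_def)
  qed
  ultimately show ?thesis by blast
qed

text \<open>Suppose \<open>b\<close> separates \<open>p\<close> and \<open>q\<close> although their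
  traces on \<open>M\<close> agree. For a small reflecting \<open>N\<close> containing
  \<open>b\<close>, both can be moved into the closure over \<open>M \<inter> N\<close> without
  changing their traces on \<open>N\<close>. Goodness of the small set \<open>M \<inter> N\<close>
  then identifies them, against \<open>b\<close>.\<close>

lemma closed_good:
  assumes M: "op_closed \<Phi> M"
  shows "good B M"
  unfolding good_iff
proof (intro ballI impI, rule ccontr)
  fix p q assume p: "p \<in> closure_Ult B M" and q: "q \<in> closure_Ult B M"
    and eq: "p \<inter> M = q \<inter> M" and "p \<noteq> q"
  then obtain b where b: "b \<in> p" "b \<notin> q"
    using Ult_eqI[of p q] closure_UltD by blast
  obtain N where N: "b \<in> N" "op_closed \<Phi> N" "small N"
    and refl: "N \<inter> \<Union>(named_Ult B M) \<subseteq> \<Union>(named_Ult B (M \<inter> N))"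
    using exists_small_reflecting[OF small_finite[of "{b}"], of M] by auto
  have MN: "op_closed \<Phi> (M \<inter> N)" using M N(2) by (rule op_closed_Int)
  have ex: "\<exists>s \<in> closure_Ult B (M \<inter> N). s \<inter> N = t \<inter> N" if t: "t \<in> closure_Ult B M" for t
  proof -
    have "t \<inter> N \<subseteq> \<Union>(named_Ult B (M \<inter> N))"
      using t refl by (auto simp: closure_Ult_def)
    then show ?thesis
      using exists_same_trace[OF N(2), of t "named_Ult B (M \<inter> N)"] t
      by (auto simp: closure_Ult_def named_Ult_def)
  qed
  obtain p' q' where p': "p' \<in> closure_Ult B (M \<inter> N)" "p' \<inter> N = p \<inter> N"
    and q': "q' \<in> closure_Ult B (M \<inter> N)" "q' \<inter> N = q \<inter> N"
    using ex[OF p] ex[OF q] by blast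
  have "p' \<inter> (M \<inter> N) = q' \<inter> (M \<inter> N)"
    using p'(2) q'(2) eq by blast
  moreover have "good B (M \<inter> N)"
    using small_good[OF MN] small_subset[OF N(3)] by auto
  ultimately have "p' = q'"
    using p'(1) q'(1) by (auto simp: good_iff)
  then show False using b N(1) p'(2) q'(2) by blast
qed

lemma closure_Ult_eqI:
  "\<lbrakk>op_closed \<Phi> M; p \<in> closure_Ult B M; q \<in> closure_Ult B M; p \<inter> M = q \<inter> M\<rbrakk> \<Longrightarrow> p = q"
  using closed_good by (auto simp: good_iff)

text \<open>Put the name of \<open>p\<close> into a small reflecting \<open>N\<close>. Compactness
  gives \<open>q\<close> in the closure over \<open>M \<inter> N\<close> with the trace of
  \<open>p\<close> on \<open>N\<close>; both lie in the closure over \<open>N\<close>, so goodness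
  of \<open>N\<close> yields \<open>q = p\<close>.\<close>

lemma closure_Ult_tight:
  assumes M: "op_closed \<Phi> M" and p: "p \<in> closure_Ult B M"
  shows "\<exists>N\<subseteq>M. small N \<and> p \<in> closure_Ult B N"
proof -
  obtain N where N: "vset p \<in> N" "op_closed \<Phi> N" "small N"
    and refl: "N \<inter> \<Union>(named_Ult B M) \<subseteq> \<Union>(named_Ult B (M \<inter> N))"
    using exists_small_reflecting[OF small_finite[of "{vset p}"], of M] by auto
  have "p \<inter> N \<subseteq> \<Union>(named_Ult B (M \<inter> N))"
    using p refl by (auto simp: closure_Ult_def)
  then obtain q where q: "q \<in> closure_Ult B (M \<inter> N)" "q \<inter> N = p \<inter> N"
    using exists_same_trace[OF N(2) closure_UltD[OF p], of "named_Ult B (M \<inter> N)"]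
    by (auto simp: closure_Ult_def named_Ult_def)
  have "q \<in> closure_Ult B N"
    using q(1) closure_Ult_mono[of "M \<inter> N" N B] by auto
  then have "q = p"
    using closure_Ult_eqI[OF N(2)] named_in_closure_Ult[OF closure_UltD[OF p] N(1)] q(2) by blast
  moreover have "small (M \<inter> N)" using small_subset[OF N(3)] by auto
  ultimately show ?thesis using q(1) by blast
qed

text \<open>The ultrafilters containing \<open>b\<close> but not \<open>a\<close> form a clopen set;
  missing the named ones, it misses their closure.\<close>

lemma agree_on_closure:
  assumes "a \<in> carrier B" "b \<in> carrier B"
    and "\<And>r. r \<in> named_Ult B M \<Longrightarrow> b \<in> r \<Longrightarrow> a \<in> r"
    and p: "p \<in> closure_Ult B M" "b \<in> p"
  shows "a \<in> p"
proof (rule ccontr)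
  assume "a \<notin> p"
  then have "meet B b (compl B a) \<in> p"
    using assms closure_UltD[OF p(1)] by (simp add: meet_in_Ult compl_in_Ult compl_closed)
  then obtain r where r: "r \<in> named_Ult B M" "meet B b (compl B a) \<in> r"
    using p(1) by (auto simp: closure_Ult_def)
  then have "r \<in> Ult B" by (simp add: named_Ult_def)
  then show False
    using r assms(1-3) by (auto simp: meet_in_Ult compl_in_Ult compl_closed)
qed

text \<open>Otherwise \<open>b\<close> and \<open>compl B b\<close> are each compatible, on the
  named ultrafilters, with every element of the trace of \<open>u\<close>. Compactness then gives
  two different ultrafilters in the closure with that trace, against goodness.\<close>

lemma trace_decides:
  assumes M: "op_closed \<Phi> M" and b: "b \<in> carrier B" and u: "u \<in> closure_Ult B M"
  shows "\<exists>a\<in>u \<inter> M. (\<forall>r\<in>named_Ult B M. a \<in> r \<longrightarrow> b \<in> r) \<or> (\<forall>r\<in>named_Ult B M. a \<in> r \<longrightarrow> b \<notin> r)"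
proof (rule ccontr)
  assume neg: "\<not> ?thesis"
  note uU = closure_UltD[OF u]
  have ex: "\<exists>p\<in>closure_Ult B M. p \<inter> M = u \<inter> M \<and> c \<in> p"
    if c: "c \<in> carrier B" and meets: "\<And>a. a \<in> u \<inter> M \<Longrightarrow> \<exists>r\<in>named_Ult B M. a \<in> r \<and> c \<in> r" for c
  proof -
    let ?A = "(\<lambda>a. meet B a c) ` (u \<inter> M)"
    have R: "named_Ult B M \<subseteq> Ult B" by (auto simp: named_Ult_def)
    have uC: "u \<inter> M \<subseteq> carrier B" using Ult_carrier[OF uU] by auto
    have one: "one B \<in> u \<inter> M" using one_in_Ult[OF uU] closed_consts[OF M] by auto
    have "\<exists>p\<in>Ult B. ?A \<subseteq> p \<and> p \<subseteq> \<Union>(named_Ult B M)"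
    proof (rule Ult_compactness[OF _ _ _ R])
      show "?A \<subseteq> carrier B" using uC c by (auto intro: meet_closed)
      show "?A \<noteq> {}" using one by blast
      show "?A \<subseteq> \<Union>(named_Ult B M)"
      proof
        fix x assume "x \<in> ?A"
        then obtain a where a: "a \<in> u \<inter> M" "x = meet B a c" by auto
        then obtain r where "r \<in> named_Ult B M" "a \<in> r" "c \<in> r" using meets by blast
        then show "x \<in> \<Union>(named_Ult B M)"
          using a uC c R meet_in_Ult[of r a c] by blast
      qed
      fix x y assume "x \<in> ?A" "y \<in> ?A"
      then obtain a a' where a: "a \<in> u \<inter> M" "x = meet B a c" "a' \<in> u \<inter> M" "y = meet B a' c" by auto
      then have aC: "a \<in> carrier B" "a' \<in> carrier B" using uC by auto
      then have "meet B x y = meet B (meet B a a') c"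
        using c unfolding a by (intro eq_if_same_Ult) (auto simp: meet_closed meet_in_Ult)
      moreover have "meet B a a' \<in> u \<inter> M"
        using a closed_ops[OF M _ _ aC] meet_in_Ult[OF uU aC] by auto
      ultimately show "meet B x y \<in> ?A" by blast
    qed
    then obtain p where p: "p \<in> Ult B" "?A \<subseteq> p" "p \<subseteq> \<Union>(named_Ult B M)" by blast
    have mem: "a \<in> p" "c \<in> p" if "a \<in> u \<inter> M" for a
      using that p(2) uC c meet_in_Ult[OF p(1), of a c] by auto
    have "p \<inter> M = u \<inter> M"
      using trace_eqI[OF M uU p(1)] mem(1) by blast
    then show ?thesis
      using p mem(2)[OF one] by (auto simp: closure_Ult_def)
  qed
  obtain p where p: "p \<in> closure_Ult B M" "p \<inter> M = u \<inter> M" "b \<in> p"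
    using ex[OF b] neg by blast
  have "\<exists>r\<in>named_Ult B M. a \<in> r \<and> compl B b \<in> r" if "a \<in> u \<inter> M" for a
    using that neg compl_in_Ult[OF _ b] by (auto simp: named_Ult_def)
  then obtain q where q: "q \<in> closure_Ult B M" "q \<inter> M = u \<inter> M" "compl B b \<in> q"
    using ex[OF compl_closed[OF b]] by blast
  have "p = q" using closure_Ult_eqI[OF M p(1) q(1)] p(2) q(2) by simp
  then show False
    using p(3) q(3) compl_in_Ult[OF closure_UltD[OF q(1)] b] by simp
qed

text \<open>The dual of the retraction \<open>Ult(B) \<rightarrow> closure_Ult B M\<close>: a retraction of \<open>B\<close> onto \<open>B \<inter> M\<close>.\<close>

lemma exists_representative:
  assumes M: "op_closed \<Phi> M" and b: "b \<in> carrier B"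
  shows "\<exists>a\<in>M \<inter> carrier B. \<forall>p\<in>closure_Ult B M. b \<in> p \<longleftrightarrow> a \<in> p"
proof -
  let ?U = "named_Ult B M"
  let ?below = "\<lambda>a. a \<in> M \<inter> carrier B \<and> (\<forall>r\<in>?U. a \<in> r \<longrightarrow> b \<in> r)"
  let ?disj = "\<lambda>a. a \<in> M \<inter> carrier B \<and> (\<forall>r\<in>?U. a \<in> r \<longrightarrow> b \<notin> r)"
  \<comment> \<open>\<open>c\<close> covers what is left of the Stone space beside \<open>a\<close>,
    which implies \<open>b\<close> on the named ultrafilters, and \<open>a'\<close>, which excludes
    \<open>b\<close> there. The aim is such a \<open>c\<close> in no named ultrafilter.\<close>
  define covered where "covered c a a' \<longleftrightarrow> c \<in> M \<inter> carrier B \<and> ?below a \<and> ?disj a' \<and>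
    (\<forall>r\<in>Ult B. c \<in> r \<or> a \<in> r \<or> a' \<in> r)" for c a a'
  define A where "A = {c. \<exists>a a'. covered c a a'}"
  have U: "?U \<subseteq> Ult B" by (auto simp: named_Ult_def)
  have zero: "zero B \<in> M \<inter> carrier B" "\<And>r. r \<in> Ult B \<Longrightarrow> zero B \<notin> r"
    using closed_consts[OF M] zero_closed zero_notin_Ult by auto
  \<comment> \<open>A finite subcover argument: otherwise compactness places all of \<open>A\<close>
    in some \<open>u\<close> of the closure, while an element of \<open>u\<close> that decides
    \<open>b\<close> has its complement in \<open>A\<close>.\<close>
  have "\<not> A \<subseteq> \<Union>?U"
  proof
    assume AU: "A \<subseteq> \<Union>?U"
    have "\<exists>u\<in>Ult B. A \<subseteq> u \<and> u \<subseteq> \<Union>?U"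
    proof (rule Ult_compactness[OF _ _ _ U AU])
      show "A \<subseteq> carrier B" by (auto simp: A_def covered_def)
      have "one B \<in> A"
        unfolding A_def covered_def using zero U closed_consts[OF M] one_closed one_in_Ult by blast
      then show "A \<noteq> {}" by auto
      fix c d assume "c \<in> A" "d \<in> A"
      then obtain a a' e e' where "covered c a a'" "covered d e e'"
        unfolding A_def by auto
      then have *: "c \<in> M \<inter> carrier B" "d \<in> M \<inter> carrier B"
        "?below a" "?disj a'" "\<forall>r\<in>Ult B. c \<in> r \<or> a \<in> r \<or> a' \<in> r"
        "?below e" "?disj e'" "\<forall>r\<in>Ult B. d \<in> r \<or> e \<in> r \<or> e' \<in> r"
        by (simp_all add: covered_def)
      have "?below (join B a e)" "?disj (join B a' e')"
        using * closed_ops[OF M, of a e] closed_ops[OF M, of a' e'] U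
        by (auto simp: join_closed join_in_Ult subset_iff)
      moreover have "\<forall>r\<in>Ult B. meet B c d \<in> r \<or> join B a e \<in> r \<or> join B a' e' \<in> r"
        using * by (auto simp: join_in_Ult meet_in_Ult)
      moreover have "meet B c d \<in> M \<inter> carrier B"
        using * closed_ops[OF M, of c d] by (auto simp: meet_closed)
      ultimately have "covered (meet B c d) (join B a e) (join B a' e')"
        by (simp add: covered_def)
      then show "meet B c d \<in> A" unfolding A_def by blast
    qed
    then obtain u where u: "u \<in> closure_Ult B M" "A \<subseteq> u" by (auto simp: closure_Ult_def)
    then obtain a where a: "a \<in> u" "a \<in> M" "(\<forall>r\<in>?U. a \<in> r \<longrightarrow> b \<in> r) \<or> (\<forall>r\<in>?U. a \<in> r \<longrightarrow> b \<notin> r)"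
      using trace_decides[OF M b] by blast
    have aC: "a \<in> carrier B" using Ult_carrier[OF closure_UltD[OF u(1)] a(1)] .
    have "?below a \<and> ?disj (zero B) \<or> ?below (zero B) \<and> ?disj a"
      using a aC zero U by blast
    moreover have "\<forall>r\<in>Ult B. compl B a \<in> r \<or> a \<in> r \<or> zero B \<in> r"
      "\<forall>r\<in>Ult B. compl B a \<in> r \<or> zero B \<in> r \<or> a \<in> r"
      using aC compl_in_Ult by auto
    moreover have "compl B a \<in> M \<inter> carrier B"
      using closed_ops[OF M a(2) a(2) aC aC] compl_closed[OF aC] by auto
    ultimately have "covered (compl B a) a (zero B) \<or> covered (compl B a) (zero B) a"
      unfolding covered_def by argo
    then have "compl B a \<in> A" unfolding A_def by blast
    then show False
      using u a(1) compl_in_Ult[OF closure_UltD[OF u(1)] aC] by auto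
  qed
  then obtain c where c: "c \<in> A" "c \<notin> \<Union>?U" by (meson subsetI)
  then obtain a a' where "covered c a a'" by (auto simp: A_def)
  then have a: "?below a" and a': "?disj a'" and cover: "\<forall>r\<in>Ult B. c \<in> r \<or> a \<in> r \<or> a' \<in> r"
    by (simp_all add: covered_def)
  have aC: "a \<in> carrier B" and ab: "\<And>r. r \<in> ?U \<Longrightarrow> a \<in> r \<Longrightarrow> b \<in> r" using a by auto
  \<comment> \<open>As \<open>c\<close> is in no named ultrafilter, each of these contains
    \<open>a\<close> or \<open>a'\<close>; those containing \<open>b\<close> omit \<open>a'\<close>,
    hence contain \<open>a\<close>.\<close>
  have ba: "a \<in> r" if "r \<in> ?U" "b \<in> r" for r
    using that c a' cover U by (meson UnionI subsetD)
  have "\<forall>p\<in>closure_Ult B M. b \<in> p \<longleftrightarrow> a \<in> p"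
    using agree_on_closure[OF aC b ba] agree_on_closure[OF b aC ab] by (intro ballI iffI)
  then show ?thesis using a by blast
qed

end

section \<open>Small generating sets along a chain of closed sets\<close>

text \<open>The hulls of initial segments form a chain, so their union is closed.
  \<open>op_closed \<Phi> hull {}\<close> keeps the chain nonempty when \<open>X\<close> is
  empty.\<close>

lemma hull_subset_initial_hulls:
  assumes r: "well_order_on A r" and X: "X \<subseteq> A"
  shows "op_closed \<Phi> hull X \<subseteq> op_closed \<Phi> hull {} \<union> (\<Union>a\<in>X. op_closed \<Phi> hull (under r a))"
    (is "_ \<subseteq> ?R")
proof (rule hull_minimal)
  interpret wo: wo_rel r
    unfolding wo_rel_def using r well_order_on_Field by metis
  have F: "Field r = A" using well_order_on_Field[OF r] by simp
  show "X \<subseteq> ?R"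
  proof
    fix a assume a: "a \<in> X"
    then have "a \<in> under r a"
      using X F wo.REFL by (auto simp: under_def refl_on_def)
    then show "a \<in> ?R"
      using a hull_subset[of "under r a" "op_closed \<Phi>"] by auto
  qed
  let ?C = "insert (op_closed \<Phi> hull {}) ((\<lambda>a. op_closed \<Phi> hull (under r a)) ` X)"
  have "op_closed \<Phi> hull (under r a) \<subseteq> op_closed \<Phi> hull (under r b) \<or>
      op_closed \<Phi> hull (under r b) \<subseteq> op_closed \<Phi> hull (under r a)" if "a \<in> X" "b \<in> X" for a b
    using that X F wo.TOTALS wo.TRANS by (meson subset_iff under_incr hull_mono)
  moreover have "op_closed \<Phi> hull {} \<subseteq> op_closed \<Phi> hull (under r a)" for a
    by (rule hull_mono) simp
  ultimately have "M \<subseteq> N \<or> N \<subseteq> M" if "M \<in> ?C" "N \<in> ?C" for M N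
    using that by (elim insertE imageE) simp_all
  then have "op_closed \<Phi> (\<Union>?C)"
    by (rule op_closed_Union_chain[rotated 2]) (auto simp: op_closed_hull)
  then show "op_closed \<Phi> ?R" by simp
qed

context regular_uncountable
begin

text \<open>\<open>S\<close> consists of the first \<open>k\<close> elements of \<open>T\<close>,
  and by regularity no small subset of it is cofinal.\<close>

lemma not_small_cofinal_part:
  assumes r: "well_order_on A r" and T: "T \<subseteq> A" "\<not> small T"
  obtains S where "S \<subseteq> T" "S \<noteq> {}"
    "\<And>N. N \<subseteq> S \<Longrightarrow> small N \<Longrightarrow> \<exists>a\<in>S. N \<subseteq> underS r a"
proof -
  interpret wo: wo_rel r
    unfolding wo_rel_def using r well_order_on_Field by metis
  have F: "Field r = A" using well_order_on_Field[OF r] by simp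
  define S where "S = {a \<in> T. small (T \<inter> underS r a)}"
  have ST: "S \<subseteq> T" by (auto simp: S_def)
  have big: "\<not> small S"
  proof (cases "S = T")
    case False
    then have ne: "T - S \<noteq> {}" using ST by auto
    \<comment> \<open>The predecessors in \<open>T\<close> of the least missing element
      \<open>c\<close> all lie in \<open>S\<close>, and they are not small because \<open>c\<close>
      is missing.\<close>
    define c where "c = wo.minim (T - S)"
    have c: "c \<in> T - S" and least: "\<And>b. b \<in> T - S \<Longrightarrow> (c, b) \<in> r"
      unfolding c_def using ne T(1) F wo.minim_in[of "T - S"] wo.minim_least[of "T - S"] by blast+
    have "T \<inter> underS r c \<subseteq> S"
    proof
      fix b assume b: "b \<in> T \<inter> underS r c"
      then have "(c, b) \<notin> r" using wo.ANTISYM by (auto simp: underS_def antisym_def)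
      then show "b \<in> S" using b least by auto
    qed
    moreover have "\<not> small (T \<inter> underS r c)" using c by (auto simp: S_def)
    ultimately show ?thesis using small_subset by blast
  qed (use T in simp)
  show ?thesis
  proof (rule that[OF ST])
    show "S \<noteq> {}" using big small_finite[of "{}"] by auto
    fix N assume N: "N \<subseteq> S" "small N"
    show "\<exists>a\<in>S. N \<subseteq> underS r a"
    proof (rule ccontr)
      assume neg: "\<not> ?thesis"
      \<comment> \<open>An unbounded small \<open>N\<close> would cover \<open>S\<close> by fewer
        than \<open>k\<close> small initial pieces of \<open>T\<close>.\<close>
      have "S \<subseteq> (\<Union>n\<in>N. insert n (T \<inter> underS r n))"
      proof
        fix a assume a: "a \<in> S"
        then obtain n where n: "n \<in> N" "n \<notin> underS r a" using neg by auto
        have "n \<in> Field r" "a \<in> Field r" using a n(1) N(1) ST T(1) F by auto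
        then have "(a, n) \<in> r" using n(2) wo.TOTALS by (auto simp: underS_def)
        then have "a \<in> insert n (T \<inter> underS r n)" using a ST by (auto simp: underS_def)
        then show "a \<in> (\<Union>n\<in>N. insert n (T \<inter> underS r n))" using n(1) by blast
      qed
      moreover have "small (\<Union>n\<in>N. insert n (T \<inter> underS r n))"
        by (intro small_UN small_insert N(2)) (use N(1) in \<open>auto simp: S_def\<close>)
      ultimately show False using big small_subset by blast
    qed
  qed
qed

end

context good_closure
begin

text \<open>The cardinal well-order of \<open>M\<close> has initial segments smaller than
  \<open>M\<close>. Their hulls form a chain of closed sets to which \<open>IH\<close>
  applies.\<close>

lemma exists_generators_step:
  assumes M: "op_closed \<Phi> M" and big: "k \<le>o |M|"
    and IH: "\<And>N. op_closed \<Phi> N \<Longrightarrow> |N| <o |M| \<Longrightarrow>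
      \<exists>G\<subseteq>carrier B \<inter> N. carrier B \<inter> N \<subseteq> generated B G \<and> (\<forall>p\<in>Ult B. small (G \<inter> p))"
  shows "\<exists>G\<subseteq>carrier B \<inter> M. carrier B \<inter> M \<subseteq> generated B G \<and> (\<forall>p\<in>Ult B. small (G \<inter> p))"
proof -
  define r where "r = |M|"
  have wo: "well_order_on M r" unfolding r_def by (rule card_of_well_order_on)
  then interpret wo: wo_rel r unfolding wo_rel_def using wo well_order_on_Field by metis
  have F: "Field r = M" using well_order_on_Field[OF wo] by simp
  define H where "H X = op_closed \<Phi> hull X" for X
  have H_closed: "op_closed \<Phi> (H X)" for X unfolding H_def by (rule op_closed_hull)
  have H_mono: "X \<subseteq> Y \<Longrightarrow> H X \<subseteq> H Y" for X Y unfolding H_def by (rule hull_mono)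
  have H_sub: "X \<subseteq> M \<Longrightarrow> H X \<subseteq> M" for X unfolding H_def by (rule hull_minimal[where S = "op_closed \<Phi>"]) (use M in auto)
  \<comment> \<open>\<open>P a\<close> and \<open>Q a\<close> are the levels just before and just
    after \<open>a\<close>. Taking the hull of all strict predecessors treats successor and limit
    stages alike.\<close>
  define P where "P a = H (underS r a)" for a
  define Q where "Q a = H (under r a)" for a
  have under_M: "under r a \<subseteq> M" "underS r a \<subseteq> M" for a
    using F by (auto simp: under_def underS_def Field_def)
  have PQ: "P a \<subseteq> Q a" for a
    unfolding P_def Q_def by (rule H_mono) (auto simp: under_def underS_def)
  have QP: "Q a \<subseteq> P b" if "a \<in> underS r b" for a b
    unfolding P_def Q_def
    by (rule H_mono) (use that wo.TRANS wo.ANTISYM in \<open>auto simp: under_def underS_def trans_def antisym_def\<close>)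
  have P_mono: "P a \<subseteq> P b" if "a \<in> underS r b" for a b
    using PQ QP[OF that] by blast
  have Q_less: "|Q a| <o |M|" if a: "a \<in> M" for a
  proof -
    have M': "Cinfinite |M|"
      using Cinfinite_k big card_of_Card_order cinfinite_mono by blast
    then have inf: "\<not> finite M" by (simp add: cinfinite_def Field_card_of)
    have "|underS r a| <o |M|"
      unfolding r_def by (rule card_of_underS[OF card_of_Card_order]) (simp add: a Field_card_of)
    moreover have "|{a}| <o |M|" using inf by (intro finite_ordLess_infinite card_of_Well_order) (simp_all add: Field_card_of)
    ultimately have "|underS r a \<union> {a}| <o |M|"
      using inf by (intro card_of_Un_ordLess_infinite)
    moreover have "under r a \<subseteq> underS r a \<union> {a}" by (auto simp: under_def underS_def)
    ultimately have "|under r a| <o |M|"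
      using card_of_mono1 ordLeq_ordLess_trans by blast
    then show ?thesis
      unfolding Q_def H_def by (rule hull_ordLess[OF small_\<Phi> _ big])
  qed
  have "\<exists>g. g \<subseteq> carrier B \<inter> Q a \<and> carrier B \<inter> Q a \<subseteq> generated B g \<and> (\<forall>p\<in>Ult B. small (g \<inter> p))"
    if "a \<in> M" for a
    using IH[OF H_closed[of "under r a"]] Q_less[OF that] by (auto simp: Q_def)
  then obtain g where g: "\<And>a. a \<in> M \<Longrightarrow> g a \<subseteq> carrier B \<inter> Q a"
    and g_gen: "\<And>a. a \<in> M \<Longrightarrow> carrier B \<inter> Q a \<subseteq> generated B (g a)"
    and g_small: "\<And>a p. a \<in> M \<Longrightarrow> p \<in> Ult B \<Longrightarrow> small (g a \<inter> p)"
    by metis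
  have "\<forall>a b. \<exists>c. b \<in> carrier B \<longrightarrow> c \<in> P a \<inter> carrier B \<and> (\<forall>p\<in>closure_Ult B (P a). b \<in> p \<longleftrightarrow> c \<in> p)"
    using exists_representative[OF H_closed] by (metis P_def)
  then obtain \<rho> where \<rho>: "\<And>a b. b \<in> carrier B \<Longrightarrow> \<rho> a b \<in> P a \<inter> carrier B"
    and \<rho>_iff: "\<And>a b p. b \<in> carrier B \<Longrightarrow> p \<in> closure_Ult B (P a) \<Longrightarrow> b \<in> p \<longleftrightarrow> \<rho> a b \<in> p"
    by metis
  \<comment> \<open>\<open>d a b\<close> and \<open>d' a b\<close> are the two halves of the
    symmetric difference of \<open>b\<close> and its retract \<open>\<rho> a b\<close>; no
    ultrafilter in \<open>closure_Ult B (P a)\<close> contains either.\<close>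
  define d where "d a b = meet B b (compl B (\<rho> a b))" for a b
  define d' where "d' a b = meet B (\<rho> a b) (compl B b)" for a b
  define g' where "g' a = d a ` g a \<union> d' a ` g a" for a
  have gC: "b \<in> carrier B" if "a \<in> M" "b \<in> g a" for a b using g[OF that(1)] that(2) by auto
  have d_iff: "d a b \<in> p \<longleftrightarrow> b \<in> p \<and> \<rho> a b \<notin> p" "d' a b \<in> p \<longleftrightarrow> \<rho> a b \<in> p \<and> b \<notin> p"
    if "b \<in> carrier B" "p \<in> Ult B" for a b p
    using that \<rho>[OF that(1), of a] by (auto simp: d_def d'_def meet_in_Ult compl_in_Ult compl_closed)
  have d_closed: "d a b \<in> carrier B" "d' a b \<in> carrier B" if "b \<in> carrier B" for a b
    using that \<rho>[OF that(1), of a] by (auto simp: d_def d'_def meet_closed compl_closed)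
  have g'_sub: "g' a \<subseteq> carrier B \<inter> Q a" if a: "a \<in> M" for a
  proof -
    have "d a b \<in> Q a \<and> d' a b \<in> Q a" if b: "b \<in> g a" for b
    proof -
      have *: "b \<in> carrier B" "b \<in> Q a" "\<rho> a b \<in> carrier B" "\<rho> a b \<in> Q a"
        using g[OF a] b \<rho>[of b a] PQ[of a] by auto
      have cl: "op_closed \<Phi> (Q a)" unfolding Q_def by (rule H_closed)
      show ?thesis
        unfolding d_def d'_def
        using closed_ops[OF cl] * compl_closed by metis
    qed
    then show ?thesis
      using gC[OF a] d_closed by (auto simp: g'_def)
  qed
  \<comment> \<open>The least closed set \<open>H {}\<close> is small, so all its carrier elements
    may be included as the start of the recursion.\<close>
  define G where "G = carrier B \<inter> H {} \<union> (\<Union>a\<in>M. g' a)"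
  have H_eq: "H X \<subseteq> H {} \<union> (\<Union>a\<in>X. Q a)" if "X \<subseteq> M" for X
    unfolding H_def Q_def by (rule hull_subset_initial_hulls[OF wo that])
  have GM: "G \<subseteq> carrier B \<inter> M"
    using H_sub[of "{}"] g'_sub H_sub[OF under_M(1)] unfolding G_def Q_def by blast
  \<comment> \<open>Induction along \<open>r\<close>: \<open>P a\<close> is covered by
    \<open>H {}\<close> and the earlier \<open>Q c\<close>, and \<open>b \<in> g a\<close> is
    recovered from \<open>\<rho> a b\<close>, which lies in \<open>P a\<close>, and the two
    differences.\<close>
  have gen: "carrier B \<inter> Q a \<subseteq> generated B G" if "a \<in> M" for a
    using that
  proof (induction a rule: wo.well_order_induct)
    case (1 a)
    have "carrier B \<inter> Q c \<subseteq> generated B G" if "c \<in> underS r a" for c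
      using 1 that under_M(2) by (auto simp: underS_def)
    moreover have "carrier B \<inter> H {} \<subseteq> generated B G"
      using generated.base[of _ G] by (auto simp: G_def)
    ultimately have P_gen: "carrier B \<inter> P a \<subseteq> generated B G"
      using H_eq[OF under_M(2)[of a]] unfolding P_def by blast
    have "b \<in> generated B G" if b: "b \<in> g a" for b
    proof -
      have bC: "b \<in> carrier B" using gC[OF \<open>a \<in> M\<close> b] .
      note \<rho>C = \<rho>[OF bC, of a] and dC = d_closed[OF bC, of a]
      let ?e = "join B (meet B (\<rho> a b) (compl B (d' a b))) (d a b)"
      have "?e = b"
        using bC \<rho>C dC
        by (intro eq_if_same_Ult)
          (auto simp: join_in_Ult meet_in_Ult compl_in_Ult d_iff meet_closed join_closed compl_closed)
      moreover have "d a b \<in> generated B G" "d' a b \<in> generated B G"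
        using b \<open>a \<in> M\<close> by (auto simp: G_def g'_def intro!: generated.base)
      moreover have "\<rho> a b \<in> generated B G" using P_gen \<rho>C by auto
      ultimately show ?thesis
        using generated.join generated.meet generated.compl by metis
    qed
    then have "generated B (g a) \<subseteq> generated B G"
      by (intro generated_mono) auto
    then show ?case using g_gen[OF \<open>a \<in> M\<close>] by blast
  qed
  have "carrier B \<inter> M \<subseteq> generated B G"
  proof
    fix x assume x: "x \<in> carrier B \<inter> M"
    then have "x \<in> H M" unfolding H_def using hull_subset[of M "op_closed \<Phi>"] by auto
    then have "x \<in> H {} \<union> (\<Union>a\<in>M. Q a)" using H_eq[of M] by auto
    then show "x \<in> generated B G"
    proof
      assume "x \<in> H {}"
      then have "x \<in> G" using x by (simp add: G_def)
      then show ?thesis by (rule generated.base)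
    qed (use x gen in blast)
  qed
  moreover have "small (G \<inter> p)" if p: "p \<in> Ult B" for p
  proof -
    \<comment> \<open>If \<open>d' a b \<in> p\<close> then \<open>\<rho> a b \<in> p\<close>, so
      \<open>b\<close> belongs to the retract \<open>q\<close> of \<open>p\<close> at
      \<open>P a\<close>. Thus level \<open>a\<close> is bounded by the traces of \<open>p\<close>
      and \<open>q\<close> on \<open>g a\<close>.\<close>
    have piece: "small (g' a \<inter> p)" if a: "a \<in> M" for a
    proof -
      obtain q where q: "q \<in> closure_Ult B (P a)" "q \<inter> P a = p \<inter> P a"
        using exists_retract[OF H_closed p] unfolding P_def by blast
      have "g' a \<inter> p \<subseteq> d a ` (g a \<inter> p) \<union> d' a ` (g a \<inter> q)"
      proof
        fix x assume x: "x \<in> g' a \<inter> p"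
        then obtain b where b: "b \<in> g a" "x = d a b \<or> x = d' a b" by (auto simp: g'_def)
        have bC: "b \<in> carrier B" using gC[OF a b(1)] .
        have "b \<in> q" if "\<rho> a b \<in> p"
          using that q \<rho>_iff[OF bC q(1)] \<rho>[OF bC, of a] by blast
        then show "x \<in> d a ` (g a \<inter> p) \<union> d' a ` (g a \<inter> q)"
          using x b d_iff[OF bC p] by auto
      qed
      then show ?thesis
        using small_subset small_Un[OF small_image[OF g_small[OF a p]]
            small_image[OF g_small[OF a closure_UltD[OF q(1)]]]] by blast
    qed
    define T where "T = {a \<in> M. g' a \<inter> p \<noteq> {}}"
    have "small T"
    proof (rule ccontr)
      assume "\<not> small T"
      moreover have "T \<subseteq> M" by (auto simp: T_def)
      ultimately obtain S where S: "S \<subseteq> T" "S \<noteq> {}"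
        and bound: "\<And>N. N \<subseteq> S \<Longrightarrow> small N \<Longrightarrow> \<exists>a\<in>S. N \<subseteq> underS r a"
        using not_small_cofinal_part[OF wo, of T] by metis
      have SM: "S \<subseteq> M" using S(1) by (auto simp: T_def)
      \<comment> \<open>Small sets of indices are bounded in \<open>S\<close>. So by tightness the
        retract of \<open>p\<close> at \<open>L\<close> already lies in the closure over a single
        level \<open>P a\<close>, where the differences at \<open>a\<close> vanish.\<close>
      define L where "L = (\<Union>a\<in>S. P a)"
      have "P a \<subseteq> P b \<or> P b \<subseteq> P a" if "a \<in> S" "b \<in> S" for a b
      proof -
        have "a = b \<or> a \<in> underS r b \<or> b \<in> underS r a"
          using that SM F wo.TOTALS by (auto simp: underS_def)
        then show ?thesis using P_mono by blast
      qed
      then have "op_closed \<Phi> L"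
        unfolding L_def using S(2) H_closed
        by (intro op_closed_Union_chain) (auto simp: P_def)
      then obtain q where q: "q \<in> closure_Ult B L" "q \<inter> L = p \<inter> L"
        using exists_retract p by blast
      obtain N where N: "N \<subseteq> L" "small N" "q \<in> closure_Ult B N"
        using closure_Ult_tight[OF \<open>op_closed \<Phi> L\<close> q(1)] by blast
      obtain f where f: "\<And>n. n \<in> N \<Longrightarrow> f n \<in> S \<and> n \<in> P (f n)"
        using N(1) unfolding L_def by (metis UN_E subsetD)
      obtain a where a: "a \<in> S" "f ` N \<subseteq> underS r a"
        using bound[of "f ` N"] small_image[OF N(2)] f by blast
      have "N \<subseteq> P a" using f P_mono a(2) by blast
      then have qa: "q \<in> closure_Ult B (P a)"
        using N(3) closure_Ult_mono by blast
      \<comment> \<open>A later index \<open>c\<close> puts \<open>Q a\<close>, and with it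
        \<open>g' a\<close>, inside \<open>L\<close>, where \<open>p\<close> and \<open>q\<close>
        agree.\<close>
      obtain c where c: "c \<in> S" "a \<in> underS r c"
        using bound[of "{a}"] a(1) small_finite[of "{a}"] by auto
      have aM: "a \<in> M" using a(1) SM by auto
      obtain x where x: "x \<in> g' a" "x \<in> p" using a(1) S(1) by (auto simp: T_def)
      have "x \<in> L"
        using x(1) g'_sub[OF aM] QP[OF c(2)] c(1) unfolding L_def by blast
      then have xq: "x \<in> q" using x(2) q(2) by blast
      obtain b where b: "b \<in> g a" "x = d a b \<or> x = d' a b" using x(1) by (auto simp: g'_def)
      then show False
        using xq d_iff[OF gC[OF aM b(1)] closure_UltD[OF qa]] \<rho>_iff[OF gC[OF aM b(1)] qa] by auto
    qed
    then have "small (\<Union>a\<in>T. g' a \<inter> p)"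
      by (rule small_UN) (simp add: T_def piece)
    moreover have "small (H {})"
      unfolding H_def by (intro small_hull small_\<Phi> small_finite) simp
    ultimately have "small (H {} \<union> (\<Union>a\<in>T. g' a \<inter> p))"
      by (intro small_Un)
    then show ?thesis
      by (rule small_subset) (auto simp: G_def T_def)
  qed
  ultimately show ?thesis using GM by blast
qed

text \<open>Induction on the cardinality of \<open>M\<close>; for small \<open>M\<close> the whole
  of \<open>carrier B \<inter> M\<close> serves as generating set.\<close>

lemma exists_generators:
  "op_closed \<Phi> M \<Longrightarrow>
    \<exists>G\<subseteq>carrier B \<inter> M. carrier B \<inter> M \<subseteq> generated B G \<and> (\<forall>p\<in>Ult B. small (G \<inter> p))"
proof (induction M rule: wf_induct[OF wf_inv_image[OF wf_ordLess, of card_of]])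
  case (1 M)
  show ?case
  proof (cases "small M")
    case True
    then show ?thesis
      by (intro exI[of _ "carrier B \<inter> M"]) (auto intro: generated.base small_subset)
  next
    case False
    then have "k \<le>o |M|"
      using ordLess_or_ordLeq[OF card_of_Well_order card_order_on_well_order_on[OF card_k]] by auto
    show ?thesis
    proof (rule exists_generators_step[OF 1(2) \<open>k \<le>o |M|\<close>])
      fix N :: "'v set" assume "op_closed \<Phi> N" "|N| <o |M|"
      then show "\<exists>G\<subseteq>carrier B \<inter> N. carrier B \<inter> N \<subseteq> generated B G \<and> (\<forall>p\<in>Ult B. small (G \<inter> p))"
        using 1(1)[rule_format, of N] by simp
    qed
  qed
qed

lemma exists_small_generators:
  "\<exists>G\<subseteq>carrier B. generated B G = carrier B \<and> (\<forall>p\<in>Ult B. small (G \<inter> p))"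
proof -
  \<comment> \<open>The whole type is closed under \<open>\<Phi>\<close>. The induction runs over
    HOL sets, so \<open>M\<close> may be a proper class.\<close>
  obtain G where G: "G \<subseteq> carrier B" "carrier B \<subseteq> generated B G" "\<forall>p\<in>Ult B. small (G \<inter> p)"
    using exists_generators[of UNIV] by (auto simp: op_closed_def)
  then show ?thesis
    using generated_subset_carrier[OF G(1)] by blast
qed

end

section \<open>Sets of the universe\<close>

lemma elts_inject: "elts x = elts y \<longleftrightarrow> x = y"
  using extensionality by blast

lemma vset_elts [simp]: "vset (elts x) = x"
  unfolding vset_def by (rule the_equality) (auto simp: elts_inject)

lemma elts_vset: "X \<in> range elts \<Longrightarrow> elts (vset X) = X"
  by auto

lemma range_elts_subset:
  assumes "X \<in> range elts" "Y \<subseteq> X"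
  shows "Y \<in> range elts"
proof -
  obtain x where "X = elts x" using assms(1) by auto
  then obtain y where "elts y = Y" using assms(2) separation[of Y x] by auto
  then show ?thesis by auto
qed

lemma range_elts_image:
  fixes X :: "'v::zfc_universe set" and f :: "'v \<Rightarrow> 'v"
  assumes "X \<in> range elts"
  shows "f ` X \<in> range elts"
proof -
  obtain x where "X = elts x" using assms by auto
  moreover obtain y where "elts y = f ` elts x" using replacement by blast
  ultimately show ?thesis by (metis rangeI)
qed

text \<open>The index set may live in any HOL type; replacement applies to the codes
  \<open>vset (A i)\<close>.\<close>

lemma range_elts_UN:
  fixes A :: "'i \<Rightarrow> 'v::zfc_universe set"
  assumes I: "|I| \<le>o |elts (x :: 'v)|" and A: "\<And>i. i \<in> I \<Longrightarrow> A i \<in> range elts"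
  shows "(\<Union>i\<in>I. A i) \<in> range elts"
proof (cases "I = {}")
  case True
  then show ?thesis using separation[of "{}" x] by (metis UN_empty empty_subsetI rangeI)
next
  case False
  then obtain f where f: "I = f ` elts x"
    using I by (metis card_of_ordLeq2)
  obtain y where y: "elts y = (\<lambda>j. vset (A (f j))) ` elts x"
    using replacement by blast
  obtain u where "elts u = (\<Union>z\<in>elts y. elts z)"
    using union by blast
  also have "\<dots> = (\<Union>i\<in>I. A i)"
    using A by (auto simp: y f elts_vset)
  finally show ?thesis by (metis rangeI)
qed

lemma range_elts_ordLeq:
  assumes X: "|X| \<le>o |elts (x :: 'v::zfc_universe)|"
  shows "(X :: 'v set) \<in> range elts"
proof (cases "X = {}")
  case True
  then show ?thesis using separation[of "{}" x] by (metis empty_subsetI rangeI)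
next
  case False
  then obtain f where "X = f ` elts x"
    using X by (metis card_of_ordLeq2)
  then show ?thesis using replacement by (metis rangeI)
qed

lemma nat_ordLeq_infinite: "infinite A \<Longrightarrow> |UNIV :: nat set| \<le>o |A|"
  by (simp add: infinite_iff_card_of_nat)

lemma range_elts_finite:
  assumes "finite X"
  shows "(X :: 'v::zfc_universe set) \<in> range elts"
proof -
  obtain x :: 'v where "infinite (elts x)" using infinity by blast
  then have "|X| <o |elts x|"
    using assms by (intro finite_ordLess_infinite card_of_Well_order) (simp_all add: Field_card_of)
  then show ?thesis by (intro range_elts_ordLeq ordLess_imp_ordLeq)
qed

lemma range_elts_UN_nat:
  fixes A :: "nat \<Rightarrow> 'v::zfc_universe set"
  assumes "\<And>n. A n \<in> range elts"
  shows "(\<Union>n. A n) \<in> range elts"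
proof -
  obtain x :: 'v where "infinite (elts x)" using infinity by blast
  from range_elts_UN[OF nat_ordLeq_infinite[OF this]] assms show ?thesis by blast
qed

lemma range_elts_UN_mem:
  fixes A :: "'v::zfc_universe \<Rightarrow> 'v set"
  assumes I: "I \<in> range elts" and A: "\<And>i. i \<in> I \<Longrightarrow> A i \<in> range elts"
  shows "(\<Union>i\<in>I. A i) \<in> range elts"
proof -
  obtain x where "I = elts x" using I by auto
  then have "|I| \<le>o |elts x|" using card_of_mono1 by blast
  then show ?thesis using A by (rule range_elts_UN)
qed

lemma range_elts_Un:
  assumes "X \<in> range elts" "Y \<in> range elts"
  shows "X \<union> Y \<in> range elts"
proof -
  have "\<Union>{X, Y} = (\<Union>n::nat. if n = 0 then X else Y)"
    by (auto split: if_splits)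
  also have "\<dots> \<in> range elts"
    by (rule range_elts_UN_nat) (use assms in auto)
  finally show ?thesis by simp
qed

lemma elts_vset_finite [simp]: "finite X \<Longrightarrow> elts (vset X) = X"
  by (simp add: elts_vset range_elts_finite)

lemma vset_inject: "X \<in> range elts \<Longrightarrow> Y \<in> range elts \<Longrightarrow> vset X = vset Y \<longleftrightarrow> X = Y"
  by (metis elts_vset)

lemma vpair_inject [simp]: "vpair x y = vpair x' y' \<longleftrightarrow> x = x' \<and> y = y'"
  unfolding vpair_def by (auto simp: vset_inject range_elts_finite doubleton_eq_iff)

lemma range_elts_vgraph2:
  assumes "A \<in> range elts"
  shows "{vpair (vpair x y) (f x y) | x y. x \<in> A \<and> y \<in> A} \<in> range elts"
proof -
  have "{vpair (vpair x y) (f x y) | x y. x \<in> A \<and> y \<in> A} = (\<Union>x\<in>A. (\<lambda>y. vpair (vpair x y) (f x y)) ` A)"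
    by auto
  also have "\<dots> \<in> range elts"
    by (rule range_elts_UN_mem[OF assms range_elts_image[OF assms]])
  finally show ?thesis .
qed

subsection \<open>Transitive closures and \<open>H \<theta>\<close>\<close>

lemma trans_closure_elts: "y \<in> elts x \<Longrightarrow> y \<in> trans_closure x"
  by (auto simp: trans_closure_def)

lemma trans_closure_step: "z \<in> elts y \<Longrightarrow> y \<in> trans_closure x \<Longrightarrow> z \<in> trans_closure x"
  unfolding trans_closure_def by (auto intro: trancl_into_trancl2)

lemma trans_closure_mono: "y \<in> trans_closure x \<Longrightarrow> trans_closure y \<subseteq> trans_closure x"
  unfolding trans_closure_def by (auto intro: trancl_trans)

lemma trans_closure_least:
  assumes "elts x \<subseteq> T" "\<And>y. y \<in> T \<Longrightarrow> elts y \<subseteq> T"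
  shows "trans_closure x \<subseteq> T"
proof
  fix y assume "y \<in> trans_closure x"
  then have "(y, x) \<in> {(u, v). u \<in> elts v}\<^sup>+" by (simp add: trans_closure_def)
  then show "y \<in> T"
    by (induction rule: converse_trancl_induct) (use assms in auto)
qed

lemma range_elts_trans_closure: "trans_closure x \<in> range elts"
proof -
  let ?E = "\<lambda>n. ((\<lambda>X. \<Union>y\<in>X. elts y) ^^ n) (elts x)"
  have "?E n \<in> range elts" for n
    by (induction n) (auto intro!: range_elts_UN_mem)
  then have "(\<Union>n. ?E n) \<in> range elts"
    by (rule range_elts_UN_nat)
  moreover have "trans_closure x \<subseteq> (\<Union>n. ?E n)"
  proof (rule trans_closure_least)
    have "elts x = ?E 0" by simp
    then show "elts x \<subseteq> (\<Union>n. ?E n)" by blast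
  next
    fix y assume "y \<in> (\<Union>n. ?E n)"
    then obtain n where "y \<in> ?E n" by blast
    then have "elts y \<subseteq> ?E (Suc n)" by auto
    then show "elts y \<subseteq> (\<Union>n. ?E n)" by blast
  qed
  ultimately show ?thesis by (rule range_elts_subset)
qed

lemma H_transitive: "x \<in> H \<theta> \<Longrightarrow> y \<in> trans_closure x \<Longrightarrow> y \<in> H \<theta>"
  unfolding H_def using card_of_mono1[OF trans_closure_mono] ordLeq_ordLess_trans by blast

lemma H_elts: "x \<in> H \<theta> \<Longrightarrow> y \<in> elts x \<Longrightarrow> y \<in> H \<theta>"
  by (rule H_transitive[OF _ trans_closure_elts])

lemma H_subset:
  assumes "x \<in> H \<theta>" "elts y \<subseteq> elts x"
  shows "y \<in> H \<theta>"
proof -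
  have "trans_closure y \<subseteq> trans_closure x"
    by (rule trans_closure_least) (use assms(2) trans_closure_elts trans_closure_step in blast)+
  then show ?thesis
    using assms(1) card_of_mono1 ordLeq_ordLess_trans unfolding H_def by blast
qed

lemma H_vpair:
  assumes "vpair x y \<in> H \<theta>"
  shows "x \<in> H \<theta>" "y \<in> H \<theta>"
proof -
  have "vset {x, y} \<in> H \<theta>" using H_elts[OF assms] by (simp add: vpair_def)
  then show "x \<in> H \<theta>" "y \<in> H \<theta>" using H_elts by fastforce+
qed

section \<open>Ordinals and cardinals of the universe\<close>

lemma elts_irrefl: "x \<notin> elts (x :: 'v::zfc_universe)"
  using wf_not_refl[OF foundation, of x] by auto

lemma vordinal_mem: "vordinal \<beta> \<Longrightarrow> \<alpha> \<in> elts \<beta> \<Longrightarrow> vordinal \<alpha>"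
  unfolding vordinal_def vtransitive_def by (meson subsetD)

lemma vordinal_trans: "vordinal \<gamma> \<Longrightarrow> \<beta> \<in> elts \<gamma> \<Longrightarrow> \<alpha> \<in> elts \<beta> \<Longrightarrow> \<alpha> \<in> elts \<gamma>"
  by (auto simp: vordinal_def vtransitive_def)

text \<open>By double membership induction, two ordinals neither of which is a member of the other
  have the same members.\<close>

lemma vordinal_linear:
  fixes \<alpha> \<beta> :: "'v::zfc_universe"
  assumes "vordinal \<alpha>" "vordinal \<beta>"
  shows "\<alpha> \<in> elts \<beta> \<or> \<alpha> = \<beta> \<or> \<beta> \<in> elts \<alpha>"
  using assms
proof (induction \<alpha> arbitrary: \<beta> rule: wf_induct_rule[OF foundation])
  case (1 \<alpha>)
  note IH = 1(1) and \<alpha> = 1(2)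
  show ?case
    using 1(3)
  proof (induction \<beta> rule: wf_induct_rule[OF foundation])
    case (1 \<beta>)
    note IH' = 1(1) and \<beta> = 1(2)
    show ?case
    proof (rule ccontr)
      assume neg: "\<not> ?thesis"
      have "elts \<alpha> = elts \<beta>"
      proof (intro equalityI subsetI)
        fix \<gamma> assume "\<gamma> \<in> elts \<alpha>"
        then show "\<gamma> \<in> elts \<beta>"
          using IH[of \<gamma> \<beta>] \<beta> vordinal_mem[OF \<alpha>] neg vordinal_trans[OF \<alpha>] by auto
      next
        fix \<gamma> assume "\<gamma> \<in> elts \<beta>"
        then show "\<gamma> \<in> elts \<alpha>"
          using IH'[of \<gamma>] vordinal_mem[OF \<beta>] neg vordinal_trans[OF \<beta>] by auto
      qed
      then show False using neg elts_inject by auto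
    qed
  qed
qed

lemma vordinal_subset_if_card_less:
  assumes "vordinal \<mu>" "vordinal \<theta>" "|elts \<mu>| <o |elts \<theta>|"
  shows "elts \<mu> \<subseteq> elts \<theta>"
proof -
  have "\<not> elts \<theta> \<subseteq> elts \<mu>"
    using assms(3) card_of_mono1 not_ordLess_ordLeq by blast
  then show ?thesis
    using vordinal_linear[OF assms(1,2)] vordinal_trans[OF assms(1)] vordinal_trans[OF assms(2)] by blast
qed

text \<open>Membership well-orders \<open>elts \<kappa>\<close>. The cardinal of \<open>X\<close> is
  isomorphic to a proper initial segment of this order, which lies inside some
  \<open>elts \<alpha>\<close>.\<close>

lemma vcardinal_bound:
  assumes \<kappa>: "vcardinal \<kappa>" and X: "|X| <o |elts \<kappa>|"
  shows "\<exists>\<alpha>\<in>elts \<kappa>. |X| \<le>o |elts \<alpha>|"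
proof -
  define r where "r = {(\<alpha>, \<beta>). \<alpha> \<in> elts \<kappa> \<and> \<beta> \<in> elts \<kappa> \<and> (\<alpha> \<in> elts \<beta> \<or> \<alpha> = \<beta>)}"
  have ord: "vordinal \<kappa>" using \<kappa> by (simp add: vcardinal_def)
  note ords = vordinal_mem[OF ord]
  have F: "Field r = elts \<kappa>" by (auto simp: r_def Field_def)
  have "wf (r - Id)"
    by (rule wf_subset[OF foundation]) (auto simp: r_def)
  moreover have "trans r" "antisym r"
    using vordinal_trans[OF ords] elts_irrefl by (auto simp: r_def trans_def intro!: antisymI)
  moreover have "total_on (elts \<kappa>) r" "refl_on (elts \<kappa>) r" "r \<subseteq> elts \<kappa> \<times> elts \<kappa>"
    using ords vordinal_linear by (auto simp: r_def total_on_def refl_on_def)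
  ultimately have wo: "well_order_on (elts \<kappa>) r"
    by (simp add: well_order_on_def linear_order_on_def partial_order_on_def preorder_on_def)
  then have "|X| <o r"
    using X card_of_least ordLess_ordLeq_trans by blast
  then obtain \<alpha> where \<alpha>: "\<alpha> \<in> Field r" "|X| =o Restr r (underS r \<alpha>)"
    using wo F ordLess_iff_ordIso_Restr[OF _ card_of_Well_order, of r] by auto
  then obtain f where "iso |X| (Restr r (underS r \<alpha>)) f"
    by (auto simp: ordIso_def)
  then have "bij_betw f X (Field (Restr r (underS r \<alpha>)))"
    by (simp add: iso_def Field_card_of)
  moreover have "Field (Restr r (underS r \<alpha>)) \<subseteq> elts \<alpha>"
    by (auto simp: Field_def underS_def r_def)
  ultimately have "|X| \<le>o |elts \<alpha>|"
    using card_of_ordLeq[of X "elts \<alpha>"] unfolding bij_betw_def by (metis subset_trans order_refl)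
  then show ?thesis using \<alpha>(1) F by auto
qed

text \<open>\<open>\<theta>\<close> is the Mostowski collapse of the HOL successor cardinal of
  \<open>|elts x|\<close>, which is regular.\<close>

lemma exists_regular_vcardinal:
  fixes x :: "'v::zfc_universe"
  assumes inf: "infinite (elts x)"
  shows "\<exists>\<theta>::'v. regular_vcardinal \<theta> \<and> |elts x| <o |elts \<theta>|"
proof -
  define r where "r = cardSuc |elts x|"
  have Cx: "Cinfinite |elts x|"
    using inf card_of_Card_order by (auto simp: cinfinite_def Field_card_of)
  have Cr: "Cinfinite r" unfolding r_def using Cx by (rule Cinfinite_cardSuc)
  have wo: "Well_order r" using Cr by (simp add: card_order_on_well_order_on)
  then have wf: "wf (r - Id)" by (simp add: well_order_on_def)
  interpret wo_rel r using wo by (simp add: wo_rel_def)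
  \<comment> \<open>The collapse sends \<open>a\<close> to the set of earlier values. This is a set
    because initial segments of the successor have at most \<open>|elts x|\<close> elements.\<close>
  define f :: "'v set \<Rightarrow> 'v" where "f = wfrec (r - Id) (\<lambda>g a. vset (g ` underS a))"
  have f: "f a = vset (f ` underS a)" for a
  proof -
    have "cut f (r - Id) a ` underS a = f ` underS a"
      by (rule image_cong) (auto simp: cut_def underS_def)
    then show ?thesis
      unfolding f_def by (subst wfrec[OF wf]) simp
  qed
  have below: "|underS a| \<le>o |elts x|" if "a \<in> Field r" for a
    using card_of_underS[OF _ that] Cr cardSuc_ordLeq_ordLess[OF card_of_Card_order card_of_Card_order]
    unfolding r_def by blast
  have elts_f: "elts (f a) = f ` underS a" if "a \<in> Field r" for a
  proof -
    have "|f ` underS a| \<le>o |elts x|"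
      using card_of_image below[OF that] by (rule ordLeq_transitive)
    then have "f ` underS a \<in> range elts" by (rule range_elts_ordLeq)
    then show ?thesis unfolding f[of a] by (rule elts_vset)
  qed
  have inj: "inj_on f (Field r)"
  proof (rule inj_onI, rule ccontr)
    fix a b assume ab: "a \<in> Field r" "b \<in> Field r" "f a = f b" "a \<noteq> b"
    then have "a \<in> underS b \<or> b \<in> underS a"
      using TOTALS by (auto simp: underS_def)
    then have "f a \<in> elts (f b) \<or> f b \<in> elts (f a)"
      using elts_f ab by blast
    then show False using ab(3) elts_irrefl by metis
  qed
  define \<theta> where "\<theta> = vset (f ` Field r)"
  have elts_\<theta>: "elts \<theta> = f ` Field r"
    unfolding \<theta>_def
  proof (rule elts_vset)
    \<comment> \<open>The successor is at most the size of the power set of \<open>x\<close>, so the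
      range of the collapse is a set.\<close>
    obtain p where p: "elts p = {y. elts y \<subseteq> elts x}" using power_set by blast
    have "inj_on vset (Pow (elts x))"
      by (rule inj_onI) (metis PowD elts_vset range_elts_subset rangeI)
    moreover have "vset ` Pow (elts x) \<subseteq> elts p"
    proof
      fix y assume "y \<in> vset ` Pow (elts x)"
      then obtain Y where Y: "Y \<subseteq> elts x" "y = vset Y" by auto
      have "elts y = Y" unfolding Y(2) by (rule elts_vset) (rule range_elts_subset[OF rangeI Y(1)])
      then show "y \<in> elts p" using p Y(1) by auto
    qed
    ultimately have "|Pow (elts x)| \<le>o |elts p|"
      using card_of_ordLeq by blast
    moreover have "r \<le>o |Pow (elts x)|"
      unfolding r_def by (intro cardSuc_least card_of_Card_order card_of_Pow)
    moreover have "|f ` Field r| \<le>o r"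
      using card_of_image card_of_Field_ordIso[of r] Cr ordLeq_ordIso_trans by blast
    ultimately have "|f ` Field r| \<le>o |elts p|"
      by (meson ordLeq_transitive)
    then show "f ` Field r \<in> range elts"
      by (rule range_elts_ordLeq)
  qed
  have card_\<theta>: "r =o |elts \<theta>|"
  proof -
    have "|Field r| =o |elts \<theta>|"
      using inj elts_\<theta> card_of_ordIso[of "Field r" "elts \<theta>"] by (auto simp: bij_betw_def)
    then show ?thesis
      using card_of_Field_ordIso Cr ordIso_symmetric ordIso_transitive by blast
  qed
  have trans_f: "vtransitive (f a)" if aF: "a \<in> Field r" for a
    unfolding vtransitive_def
  proof
    fix y assume "y \<in> elts (f a)"
    then obtain b where b: "b \<in> underS a" "y = f b" using elts_f[OF aF] by auto
    then have "b \<in> Field r" by (auto simp: underS_def Field_def)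
    moreover have "underS b \<subseteq> underS a"
      using b(1) underS_incr[OF TRANS ANTISYM] by (simp add: underS_def)
    ultimately show "elts y \<subseteq> elts (f a)"
      using b(2) elts_f aF by auto
  qed
  have "vtransitive \<theta>"
    using elts_f unfolding vtransitive_def elts_\<theta> by (auto simp: underS_def Field_def)
  then have "vordinal \<theta>"
    using trans_f by (auto simp: vordinal_def elts_\<theta>)
  moreover have "|elts \<alpha>| <o |elts \<theta>|" if \<alpha>: "\<alpha> \<in> elts \<theta>" for \<alpha>
  proof -
    obtain a where a: "a \<in> Field r" "\<alpha> = f a" using \<alpha> elts_\<theta> by auto
    have "|elts \<alpha>| \<le>o |underS a|" using elts_f[OF a(1)] a(2) card_of_image by auto
    moreover have "|underS a| <o r" using card_of_underS[OF _ a(1)] Cr by blast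
    ultimately show ?thesis
      using card_\<theta> ordLeq_ordLess_trans ordLess_ordIso_trans by blast
  qed
  moreover have "regularCard |elts \<theta>|"
    using regularCard_ordIso[OF card_\<theta> Cr] regularCard_cardSuc[OF Cx] by (simp add: r_def)
  moreover have "|elts x| <o |elts \<theta>|"
    using cardSuc_greater[OF card_of_Card_order, of "elts x"] card_\<theta> ordLess_ordIso_trans
    unfolding r_def by blast
  moreover from this have "infinite (elts \<theta>)"
    using inf card_of_ordLeq_infinite ordLess_imp_ordLeq by blast
  ultimately show ?thesis
    by (auto simp: regular_vcardinal_def vcardinal_def)
qed

lemma exists_large_regular_vcardinal:
  fixes X :: "'v::zfc_universe set"
  assumes X: "X \<in> range elts"
  obtains \<mu> :: 'v where "regular_vcardinal \<mu>" "|X| <o |elts \<mu>|" "X \<subseteq> H \<mu>"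
proof -
  obtain i :: 'v where i: "infinite (elts i)" using infinity by blast
  \<comment> \<open>The transitive closures of the members give
    \<open>X \<subseteq> H \<mu>\<close>; \<open>elts i\<close> makes the set infinite.\<close>
  let ?Y = "elts i \<union> (X \<union> (\<Union>x\<in>X. trans_closure x))"
  have "?Y \<in> range elts"
    by (intro range_elts_Un range_elts_UN_mem X range_elts_trans_closure) simp
  then obtain y where y: "elts y = ?Y" by (metis imageE)
  then have "infinite (elts y)" using i by auto
  then obtain \<mu> :: 'v where \<mu>: "regular_vcardinal \<mu>" "|elts y| <o |elts \<mu>|"
    using exists_regular_vcardinal by blast
  have "|Z| <o |elts \<mu>|" if "Z \<subseteq> elts y" for Z
    using that \<mu>(2) card_of_mono1 ordLeq_ordLess_trans by blast
  then show ?thesis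
    using that[OF \<mu>(1)] unfolding H_def y by blast
qed

lemma H_mono: "elts \<mu> \<subseteq> elts \<theta> \<Longrightarrow> H \<mu> \<subseteq> H \<theta>"
  unfolding H_def using card_of_mono1 ordLess_ordLeq_trans by blast

section \<open>Definability and elementary submodels\<close>

text \<open>HOL predicates on environments stand for formulas evaluated in \<open>D\<close>, so
  formulas arise from closure lemmas instead of being written out.\<close>

definition definable_on :: "'v::zfc_universe set \<Rightarrow> ((nat \<Rightarrow> 'v) \<Rightarrow> bool) \<Rightarrow> bool" where
  "definable_on D P \<longleftrightarrow> (\<exists>\<phi>. \<forall>e. range e \<subseteq> D \<longrightarrow> (sat D e \<phi> \<longleftrightarrow> P e))"

lemma definable_mem: "definable_on D (\<lambda>e. e i \<in> elts (e j))"
  unfolding definable_on_def by (rule exI[of _ "Mem i j"]) simp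

lemma definable_eq: "definable_on D (\<lambda>e. e i = e j)"
  unfolding definable_on_def by (rule exI[of _ "Eq i j"]) simp

lemma definable_not: "definable_on D P \<Longrightarrow> definable_on D (\<lambda>e. \<not> P e)"
  unfolding definable_on_def by (metis sat.simps(3))

lemma definable_conj: "definable_on D P \<Longrightarrow> definable_on D Q \<Longrightarrow> definable_on D (\<lambda>e. P e \<and> Q e)"
  unfolding definable_on_def by (metis sat.simps(4))

lemma definable_imp: "definable_on D P \<Longrightarrow> definable_on D Q \<Longrightarrow> definable_on D (\<lambda>e. P e \<longrightarrow> Q e)"
  using definable_not[OF definable_conj[OF _ definable_not, of D P Q]] by simp

lemma definable_disj: "definable_on D P \<Longrightarrow> definable_on D Q \<Longrightarrow> definable_on D (\<lambda>e. P e \<or> Q e)"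
  using definable_imp[OF definable_not, of D P Q] by (simp add: imp_conv_disj)

lemma definable_iff: "definable_on D P \<Longrightarrow> definable_on D Q \<Longrightarrow> definable_on D (\<lambda>e. P e \<longleftrightarrow> Q e)"
  using definable_conj[OF definable_imp definable_imp, of D P Q Q P] by (simp add: iff_conv_conj_imp)

lemma definable_cong:
  "definable_on D P \<Longrightarrow> (\<And>e. range e \<subseteq> D \<Longrightarrow> P e \<longleftrightarrow> Q e) \<Longrightarrow> definable_on D Q"
  unfolding definable_on_def by auto

text \<open>\<open>k\<close> is the bound variable, and \<open>fresh\<close> says that
  \<open>Q e x\<close> does not read it. The uses take \<open>k\<close> above all free variables,
  hence the \<open>Suc\<close> of a sum of indices.\<close>

lemma definable_ex:
  assumes "definable_on D (\<lambda>e. Q e (e k))" and fresh: "\<And>e x. Q (e(k := x)) x \<longleftrightarrow> Q e x"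
  shows "definable_on D (\<lambda>e. \<exists>x\<in>D. Q e x)"
proof -
  obtain \<phi> where \<phi>: "\<And>e. range e \<subseteq> D \<Longrightarrow> sat D e \<phi> \<longleftrightarrow> Q e (e k)"
    using assms(1) by (auto simp: definable_on_def)
  have "sat D e (Ex k \<phi>) \<longleftrightarrow> (\<exists>x\<in>D. Q e x)" if "range e \<subseteq> D" for e
  proof -
    have "sat D (e(k := x)) \<phi> \<longleftrightarrow> Q e x" if "x \<in> D" for x
      using \<phi>[of "e(k := x)"] \<open>range e \<subseteq> D\<close> that fresh by (auto simp: image_subset_iff)
    then show ?thesis by simp
  qed
  then show ?thesis unfolding definable_on_def by blast
qed

lemma definable_all:
  assumes "definable_on D (\<lambda>e. Q e (e k))" and "\<And>e x. Q (e(k := x)) x \<longleftrightarrow> Q e x"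
  shows "definable_on D (\<lambda>e. \<forall>x\<in>D. Q e x)"
proof -
  have "definable_on D (\<lambda>e. \<exists>x\<in>D. \<not> Q e x)"
    by (rule definable_ex[where k = k]) (use assms in \<open>simp_all add: definable_not\<close>)
  from definable_not[OF this] show ?thesis by simp
qed

text \<open>The Tarski-Vaught property of elementary submodels: \<open>Q\<close> speaks about
  \<open>D\<close> throughout, so the witness found in \<open>M\<close> satisfies it in the sense of
  \<open>D\<close>.\<close>

lemma elementary_witness:
  assumes M: "elementary_submodel M D" and Q: "definable_on D (\<lambda>e. Q e (e k))"
    and fresh: "\<And>e x. Q (e(k := x)) x \<longleftrightarrow> Q e x"
    and e: "range e \<subseteq> M" and ex: "\<exists>x\<in>D. Q e x"
  shows "\<exists>x\<in>M. Q e x"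
proof -
  have MD: "M \<subseteq> D" using M by (simp add: elementary_submodel_def)
  obtain \<phi> where \<phi>: "\<And>e. range e \<subseteq> D \<Longrightarrow> sat D e \<phi> \<longleftrightarrow> Q e (e k)"
    using Q by (auto simp: definable_on_def)
  have upd: "range (e(k := x)) \<subseteq> D" if "x \<in> D" for x
    using e MD that by (auto simp: image_subset_iff)
  have *: "sat D (e(k := x)) \<phi> \<longleftrightarrow> Q e x" if "x \<in> D" for x
    using \<phi>[OF upd[OF that]] fresh by simp
  then have "sat D e (Ex k \<phi>)" using ex by auto
  then have "sat M e (Ex k \<phi>)" using M e unfolding elementary_submodel_def by blast
  then obtain x where x: "x \<in> M" "sat M (e(k := x)) \<phi>" by auto
  then have "range (e(k := x)) \<subseteq> M" using e by (auto simp: image_subset_iff)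
  then have "sat D (e(k := x)) \<phi>" using M x(2) by (auto simp: elementary_submodel_def)
  then show ?thesis using * x(1) MD by auto
qed

section \<open>Bounded quantifiers and pairs over a transitive class\<close>

locale transitive_class =
  fixes D :: "'v::zfc_universe set"
  assumes trans_D: "\<And>x y. x \<in> D \<Longrightarrow> y \<in> elts x \<Longrightarrow> y \<in> D"
begin

lemma vpair_in_D: "vpair x y \<in> D \<Longrightarrow> x \<in> D \<and> y \<in> D"
proof -
  assume "vpair x y \<in> D"
  from trans_D[OF this, of "vset {x, y}"] have "vset {x, y} \<in> D" by (simp add: vpair_def)
  from trans_D[OF this] show ?thesis by simp
qed

lemma definable_bex:
  assumes "definable_on D (\<lambda>e. Q e (e k))" and "k \<noteq> i" and "\<And>e x. Q (e(k := x)) x \<longleftrightarrow> Q e x"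
  shows "definable_on D (\<lambda>e. \<exists>x\<in>elts (e i). Q e x)"
proof -
  have "definable_on D (\<lambda>e. \<exists>x\<in>D. x \<in> elts (e i) \<and> Q e x)"
    by (rule definable_ex[of D _ k]) (use assms in \<open>auto intro: definable_conj definable_mem\<close>)
  then show ?thesis
    by (rule definable_cong) (auto simp: image_subset_iff intro: trans_D)
qed

lemma definable_ball:
  assumes "definable_on D (\<lambda>e. Q e (e k))" and "k \<noteq> i" and "\<And>e x. Q (e(k := x)) x \<longleftrightarrow> Q e x"
  shows "definable_on D (\<lambda>e. \<forall>x\<in>elts (e i). Q e x)"
proof -
  have "definable_on D (\<lambda>e. \<exists>x\<in>elts (e i). \<not> Q e x)"
    by (rule definable_bex[where k = k]) (use assms in \<open>simp_all add: definable_not\<close>)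
  from definable_not[OF this] show ?thesis by simp
qed

lemma definable_subset: "definable_on D (\<lambda>e. elts (e i) \<subseteq> elts (e j))"
  unfolding subset_eq
  by (rule definable_ball[where k = "Suc (i + j)"]) (auto intro: definable_mem)

lemma definable_upair: "definable_on D (\<lambda>e. elts (e u) = {e i, e j})"
proof -
  have "definable_on D (\<lambda>e. e i \<in> elts (e u) \<and> e j \<in> elts (e u) \<and> (\<forall>w\<in>elts (e u). w = e i \<or> w = e j))"
    by (intro definable_conj definable_mem definable_ball[where k = "Suc (i + j + u)"])
      (auto intro: definable_disj definable_eq)
  then show ?thesis by (rule definable_cong) auto
qed

text \<open>All quantifiers are bounded by \<open>p\<close>, as \<open>definable_bex\<close>
  requires, and \<open>{x, x}\<close> matches the shape of \<open>definable_upair\<close>.\<close>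

lemma vpair_iff:
  "p = vpair x y \<longleftrightarrow> (\<exists>u\<in>elts p. \<exists>v\<in>elts p. elts u = {x, x} \<and> elts v = {x, y} \<and> elts p = {u, v})"
proof
  assume "\<exists>u\<in>elts p. \<exists>v\<in>elts p. elts u = {x, x} \<and> elts v = {x, y} \<and> elts p = {u, v}"
  then obtain u v where "elts u = {x}" "elts v = {x, y}" "elts p = {u, v}" by auto
  then have "vset {x} = u" "vset {x, y} = v" "vset {u, v} = p"
    by (metis vset_elts)+
  then show "p = vpair x y" by (simp add: vpair_def)
qed (auto simp: vpair_def)

lemma definable_vpair: "definable_on D (\<lambda>e. e p = vpair (e i) (e j))"
  unfolding vpair_iff
  by (rule definable_bex[where k = "Suc (p + i + j)"], rule definable_bex[where k = "Suc (Suc (p + i + j))"])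
    (auto intro!: definable_conj definable_upair definable_upair[of _ i i, simplified])

lemma definable_vpair_mem: "definable_on D (\<lambda>e. vpair (e i) (e j) \<in> elts (e l))"
proof -
  have "definable_on D (\<lambda>e. \<exists>t\<in>elts (e l). t = vpair (e i) (e j))"
    by (rule definable_bex[where k = "Suc (i + j + l)"]) (auto intro: definable_vpair)
  then show ?thesis by (rule definable_cong) auto
qed

lemma definable_triple_mem: "definable_on D (\<lambda>e. vpair (vpair (e i) (e j)) (e k) \<in> elts (e l))"
proof -
  have "definable_on D (\<lambda>e. \<exists>u\<in>D. u = vpair (e i) (e j) \<and> vpair u (e k) \<in> elts (e l))"
    by (rule definable_ex[where k = "Suc (i + j + k + l)"])
      (auto intro!: definable_conj definable_vpair definable_vpair_mem)
  then show ?thesis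
  proof (rule definable_cong)
    fix e :: "nat \<Rightarrow> 'v" assume "range e \<subseteq> D"
    then have "vpair (e i) (e j) \<in> D" if "vpair (vpair (e i) (e j)) (e k) \<in> elts (e l)"
      using trans_D[OF _ that] vpair_in_D by blast
    then show "(\<exists>u\<in>D. u = vpair (e i) (e j) \<and> vpair u (e k) \<in> elts (e l)) \<longleftrightarrow>
        vpair (vpair (e i) (e j)) (e k) \<in> elts (e l)" by auto
  qed
qed

end

section \<open>First-order form of the Corson property\<close>

text \<open>The Boolean algebra is given by its carrier \<open>c\<close>, the graph \<open>m\<close> of its meet, and its constants.\<close>

definition vfilter :: "'v::zfc_universe \<Rightarrow> 'v \<Rightarrow> 'v \<Rightarrow> 'v \<Rightarrow> 'v \<Rightarrow> bool" where
  "vfilter c m z u p \<longleftrightarrow> elts p \<subseteq> elts c \<and> u \<in> elts p \<and> z \<notin> elts p \<and>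
    (\<forall>x\<in>elts p. \<forall>y\<in>elts p. \<forall>w\<in>elts c. vpair (vpair x y) w \<in> elts m \<longrightarrow> w \<in> elts p) \<and>
    (\<forall>x\<in>elts p. \<forall>y\<in>elts c. vpair (vpair x y) x \<in> elts m \<longrightarrow> y \<in> elts p)"

text \<open>Maximality is tested within \<open>D\<close>, which is genuine maximality once
  \<open>D\<close> contains the subsets of the carrier.\<close>

definition vultrafilter_in :: "'v::zfc_universe set \<Rightarrow> 'v \<Rightarrow> 'v \<Rightarrow> 'v \<Rightarrow> 'v \<Rightarrow> 'v \<Rightarrow> bool" where
  "vultrafilter_in D c m z u p \<longleftrightarrow> vfilter c m z u p \<and>
    (\<forall>q\<in>D. vfilter c m z u q \<and> elts p \<subseteq> elts q \<longrightarrow> q = p)"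

text \<open>Generation by \<open>G\<close> enters through this consequence, which is first-order
  over \<open>D\<close>.\<close>

definition vseparating :: "'v::zfc_universe set \<Rightarrow> 'v \<Rightarrow> 'v \<Rightarrow> 'v \<Rightarrow> 'v \<Rightarrow> 'v \<Rightarrow> bool" where
  "vseparating D c m z u G \<longleftrightarrow> (\<forall>p\<in>D. \<forall>q\<in>D.
    vultrafilter_in D c m z u p \<and> vultrafilter_in D c m z u q \<and>
    (\<forall>g\<in>elts G. g \<in> elts p \<longleftrightarrow> g \<in> elts q) \<longrightarrow> p = q)"

text \<open>A first-order witness for \<open>G \<inter> p\<close> having at most the cardinality of
  \<open>\<alpha>\<close>. As a partial map from \<open>\<alpha>\<close>, it makes each element
  definable from \<open>h\<close>, \<open>G\<close> and an ordinal.\<close>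

definition venumerates :: "'v::zfc_universe \<Rightarrow> 'v \<Rightarrow> 'v \<Rightarrow> 'v \<Rightarrow> bool" where
  "venumerates h \<alpha> G p \<longleftrightarrow>
    (\<forall>g\<in>elts G. g \<in> elts p \<longrightarrow> (\<exists>\<beta>\<in>elts \<alpha>. vpair \<beta> g \<in> elts h)) \<and>
    (\<forall>\<beta>\<in>elts \<alpha>. \<forall>g\<in>elts G. \<forall>g'\<in>elts G. vpair \<beta> g \<in> elts h \<and> vpair \<beta> g' \<in> elts h \<longrightarrow> g = g')"

definition vcorson_in :: "'v::zfc_universe set \<Rightarrow> 'v \<Rightarrow> 'v \<Rightarrow> 'v \<Rightarrow> 'v \<Rightarrow> 'v \<Rightarrow> 'v \<Rightarrow> bool" where
  "vcorson_in D c m z u \<kappa> G \<longleftrightarrow> vseparating D c m z u G \<and>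
    (\<forall>p\<in>D. vultrafilter_in D c m z u p \<longrightarrow> (\<exists>\<alpha>\<in>elts \<kappa>. \<exists>h\<in>D. venumerates h \<alpha> G p))"

context transitive_class
begin

lemma definable_vfilter: "definable_on D (\<lambda>e. vfilter (e c) (e m) (e z) (e u) (e p))"
proof -
  let ?k = "Suc (c + m + z + u + p)"
  have "definable_on D (\<lambda>e. \<forall>x\<in>elts (e p). \<forall>y\<in>elts (e p). \<forall>w\<in>elts (e c).
      vpair (vpair x y) w \<in> elts (e m) \<longrightarrow> w \<in> elts (e p))"
    by (rule definable_ball[where k = ?k], rule definable_ball[where k = "Suc ?k"],
        rule definable_ball[where k = "Suc (Suc ?k)"])
      (auto intro!: definable_imp definable_triple_mem definable_mem)
  moreover have "definable_on D (\<lambda>e. \<forall>x\<in>elts (e p). \<forall>y\<in>elts (e c).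
      vpair (vpair x y) x \<in> elts (e m) \<longrightarrow> y \<in> elts (e p))"
    by (rule definable_ball[where k = ?k], rule definable_ball[where k = "Suc ?k"])
      (auto intro!: definable_imp definable_triple_mem definable_mem)
  ultimately show ?thesis
    unfolding vfilter_def
    by (intro definable_conj definable_subset definable_mem definable_not)
qed

lemma definable_vultrafilter: "definable_on D (\<lambda>e. vultrafilter_in D (e c) (e m) (e z) (e u) (e p))"
  unfolding vultrafilter_in_def
  by (rule definable_conj[OF definable_vfilter], rule definable_all[where k = "Suc (c + m + z + u + p)"])
    (auto intro!: definable_imp definable_conj definable_vfilter definable_subset definable_eq)

lemma definable_vseparating: "definable_on D (\<lambda>e. vseparating D (e c) (e m) (e z) (e u) (e G))"
proof -
  let ?k = "Suc (c + m + z + u + G)"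
  have "definable_on D (\<lambda>e. \<forall>g\<in>elts (e G). g \<in> elts (e ?k) \<longleftrightarrow> g \<in> elts (e (Suc ?k)))"
    by (rule definable_ball[where k = "Suc (Suc ?k)"]) (auto intro!: definable_iff definable_mem)
  then show ?thesis
    unfolding vseparating_def
    by (intro definable_all[where k = ?k] definable_all[where k = "Suc ?k"])
      (auto intro!: definable_imp definable_conj definable_vultrafilter definable_eq)
qed

lemma definable_venumerates: "definable_on D (\<lambda>e. venumerates (e h) (e \<alpha>) (e G) (e p))"
proof -
  let ?k = "Suc (h + \<alpha> + G + p)"
  have "definable_on D (\<lambda>e. \<exists>\<beta>\<in>elts (e \<alpha>). vpair \<beta> (e ?k) \<in> elts (e h))"
    by (rule definable_bex[where k = "Suc ?k"]) (auto intro!: definable_vpair_mem)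
  then have "definable_on D (\<lambda>e. \<forall>g\<in>elts (e G). g \<in> elts (e p) \<longrightarrow> (\<exists>\<beta>\<in>elts (e \<alpha>). vpair \<beta> g \<in> elts (e h)))"
    by (intro definable_ball[where k = ?k]) (auto intro!: definable_imp definable_mem)
  moreover have "definable_on D (\<lambda>e. \<forall>\<beta>\<in>elts (e \<alpha>). \<forall>g\<in>elts (e G). \<forall>g'\<in>elts (e G).
      vpair \<beta> g \<in> elts (e h) \<and> vpair \<beta> g' \<in> elts (e h) \<longrightarrow> g = g')"
    by (rule definable_ball[where k = ?k], rule definable_ball[where k = "Suc ?k"],
        rule definable_ball[where k = "Suc (Suc ?k)"])
      (auto intro!: definable_imp definable_conj definable_vpair_mem definable_eq)
  ultimately show ?thesis
    unfolding venumerates_def by (rule definable_conj)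
qed

lemma definable_ex_venumerates:
  "definable_on D (\<lambda>e. \<exists>h\<in>D. venumerates h (e \<alpha>) (e G) (e p))"
  by (rule definable_ex[where k = "Suc (\<alpha> + G + p)"]) (auto intro!: definable_venumerates)

lemma definable_vcorson: "definable_on D (\<lambda>e. vcorson_in D (e c) (e m) (e z) (e u) (e \<kappa>) (e G))"
proof -
  let ?k = "Suc (c + m + z + u + \<kappa> + G)"
  have "definable_on D (\<lambda>e. \<exists>\<alpha>\<in>elts (e \<kappa>). \<exists>h\<in>D. venumerates h \<alpha> (e G) (e ?k))"
    by (rule definable_bex[where k = "Suc ?k"]) (auto intro!: definable_ex_venumerates)
  then show ?thesis
    unfolding vcorson_in_def
    by (intro definable_conj definable_vseparating definable_all[where k = ?k])
      (auto intro!: definable_imp definable_vultrafilter)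
qed

end

section \<open>Corson algebras have the property\<close>

lemma transitive_class_H: "transitive_class (H \<theta>)"
  by unfold_locales (rule H_elts)

text \<open>Components of a pair are unique, so the witnesses found in \<open>M\<close> are
  \<open>x\<close> and \<open>y\<close> themselves.\<close>

lemma elementary_vpair:
  assumes M: "elementary_submodel M D" and D: "transitive_class D" and xy: "vpair x y \<in> M"
  shows "x \<in> M" "y \<in> M"
proof -
  interpret transitive_class D by (rule D)
  have MD: "M \<subseteq> D" using M by (simp add: elementary_submodel_def)
  then have xyD: "x \<in> D" "y \<in> D" using vpair_in_D[OF subsetD[OF MD xy]] by simp_all
  have "\<exists>s\<in>M. \<exists>t\<in>D. vpair x y = vpair s t"
  proof (rule elementary_witness[OF M, where k = 1 and e = "\<lambda>_. vpair x y" and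
        Q = "\<lambda>e s. \<exists>t\<in>D. e 0 = vpair s t"])
    show "definable_on D (\<lambda>e. \<exists>t\<in>D. e 0 = vpair (e 1) t)"
      by (rule definable_ex[where k = 2]) (auto intro!: definable_vpair)
  qed (use xyD xy in auto)
  then show "x \<in> M" by auto
  have "\<exists>t\<in>M. \<exists>s\<in>D. vpair x y = vpair s t"
  proof (rule elementary_witness[OF M, where k = 1 and e = "\<lambda>_. vpair x y" and
        Q = "\<lambda>e t. \<exists>s\<in>D. e 0 = vpair s t"])
    show "definable_on D (\<lambda>e. \<exists>s\<in>D. e 0 = vpair s (e 1))"
      by (rule definable_ex[where k = 2]) (auto intro!: definable_vpair)
  qed (use xyD xy in auto)
  then show "y \<in> M" by auto
qed

section \<open>Ultrafilters of a set-sized algebra as elements of the universe\<close>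

locale boolean_algebra_vset = boolean_algebra_on B for B :: "'v::zfc_universe bool_alg" +
  assumes carrier_range: "carrier B \<in> range elts"
begin

abbreviation "vcarrier \<equiv> vset (carrier B)"
abbreviation "vmeet \<equiv> vgraph2 (meet B) (carrier B)"

lemma elts_vcarrier: "elts vcarrier = carrier B"
  using carrier_range by (rule elts_vset)

lemma vmeet_iff:
  assumes "x \<in> carrier B" "y \<in> carrier B"
  shows "vpair (vpair x y) w \<in> elts vmeet \<longleftrightarrow> w = meet B x y"
  using assms unfolding vgraph2_def elts_vset[OF range_elts_vgraph2[OF carrier_range]] by auto

lemma Ult_range: "p \<in> Ult B \<Longrightarrow> p \<in> range elts"
  using range_elts_subset[OF carrier_range] Ult_carrier by blast

lemma elts_vset_Ult: "p \<in> Ult B \<Longrightarrow> elts (vset p) = p"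
  by (rule elts_vset[OF Ult_range])

lemma vset_Ult_inject: "p \<in> Ult B \<Longrightarrow> q \<in> Ult B \<Longrightarrow> vset p = vset q \<longleftrightarrow> p = q"
  by (metis elts_vset_Ult)

lemma vset_Ult_range: "vset ` Ult B \<in> range elts"
proof -
  obtain P where P: "elts P = {y. elts y \<subseteq> elts vcarrier}" using power_set by blast
  have "vset ` Ult B \<subseteq> elts P"
    using Ult_carrier by (auto simp: P elts_vset_Ult elts_vcarrier)
  then show ?thesis by (rule range_elts_subset[OF rangeI])
qed

lemma vfilter_iff: "vfilter vcarrier vmeet (zero B) (one B) p \<longleftrightarrow> proper_filter B (elts p)"
proof (cases "elts p \<subseteq> carrier B")
  case True
  have 1: "(\<forall>w\<in>carrier B. vpair (vpair x y) w \<in> elts vmeet \<longrightarrow> w \<in> elts p) \<longleftrightarrow> meet B x y \<in> elts p"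
    if "x \<in> elts p" "y \<in> elts p" for x y
    using that True vmeet_iff meet_closed by (metis subsetD)
  have 2: "vpair (vpair x y) x \<in> elts vmeet \<longleftrightarrow> meet B x y = x"
    if "x \<in> elts p" "y \<in> carrier B" for x y
    using that True vmeet_iff by (metis subsetD)
  show ?thesis
    using True unfolding vfilter_def proper_filter_def elts_vcarrier
    by (simp add: 1 2 cong: ball_cong)
qed (simp add: vfilter_def proper_filter_def elts_vcarrier)

text \<open>\<open>D\<close> contains the code of every subset of the carrier, so every competing
  filter is tested.\<close>

lemma vultrafilter_iff:
  assumes D: "vcarrier \<in> D" "\<And>x y. x \<in> D \<Longrightarrow> elts y \<subseteq> elts x \<Longrightarrow> y \<in> D"
  shows "vultrafilter_in D vcarrier vmeet (zero B) (one B) p \<longleftrightarrow> elts p \<in> Ult B"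
proof
  assume p: "vultrafilter_in D vcarrier vmeet (zero B) (one B) p"
  have "q = elts p" if q: "proper_filter B q" "elts p \<subseteq> q" for q
  proof -
    have qC: "q \<subseteq> carrier B" using q(1) by (simp add: proper_filter_def)
    then have "elts (vset q) = q" by (intro elts_vset range_elts_subset[OF carrier_range])
    moreover from this have "vset q \<in> D" using D(2)[OF D(1)] qC elts_vcarrier by simp
    ultimately have "vset q = p"
      using p q by (simp add: vultrafilter_in_def vfilter_iff)
    then show ?thesis using \<open>elts (vset q) = q\<close> by simp
  qed
  then show "elts p \<in> Ult B"
    using p by (auto simp: Ult_def vultrafilter_in_def vfilter_iff)
next
  assume "elts p \<in> Ult B"
  then show "vultrafilter_in D vcarrier vmeet (zero B) (one B) p"
    by (auto simp: Ult_def vultrafilter_in_def vfilter_iff elts_inject)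
qed

lemma exists_enumeration:
  assumes \<kappa>: "vcardinal \<kappa>" and G: "G \<in> range elts" and small: "|G \<inter> p| <o |elts \<kappa>|"
    and p: "p \<in> range elts"
  shows "\<exists>h. \<exists>\<alpha>\<in>elts \<kappa>. venumerates h \<alpha> (vset G) (vset p)"
proof -
  obtain \<alpha> where \<alpha>: "\<alpha> \<in> elts \<kappa>" "|G \<inter> p| \<le>o |elts \<alpha>|"
    using vcardinal_bound[OF \<kappa> small] by blast
  then obtain j where j: "inj_on j (G \<inter> p)" "j ` (G \<inter> p) \<subseteq> elts \<alpha>"
    using card_of_ordLeq by metis
  define h where "h = vset ((\<lambda>g. vpair (j g) g) ` (G \<inter> p))"
  have "elts h = (\<lambda>g. vpair (j g) g) ` (G \<inter> p)"
    unfolding h_def by (intro elts_vset range_elts_image range_elts_subset[OF G]) simp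
  then have "venumerates h \<alpha> (vset G) (vset p)"
    unfolding venumerates_def elts_vset[OF G] elts_vset[OF p]
    using j by (auto simp: image_subset_iff inj_on_def)
  then show ?thesis using \<alpha>(1) by blast
qed

text \<open>Elementarity finds first \<open>\<alpha>\<close> and then \<open>h\<close> in
  \<open>M\<close>. Stability puts every \<open>\<beta> \<in> elts \<alpha>\<close> into
  \<open>M\<close>, and what \<open>h\<close> assigns to \<open>\<beta>\<close> is definable from
  parameters in \<open>M\<close>.\<close>

lemma enumerated_subset_elementary:
  assumes M: "elementary_submodel M D" "stable \<kappa> M" and D: "transitive_class D"
    and \<kappa>: "vordinal \<kappa>" and GM: "G \<in> M" "p \<in> M"
    and ex: "\<exists>\<alpha>\<in>elts \<kappa>. \<exists>h\<in>D. venumerates h \<alpha> G p"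
  shows "elts G \<inter> elts p \<subseteq> M"
proof
  fix g assume g: "g \<in> elts G \<inter> elts p"
  interpret transitive_class D by (rule D)
  have MD: "M \<subseteq> D" using M by (simp add: elementary_submodel_def)
  have \<kappa>M: "\<kappa> \<in> M" using M(2) by (simp add: stable_def)
  have "\<exists>\<alpha>\<in>M. \<alpha> \<in> elts \<kappa> \<and> (\<exists>h\<in>D. venumerates h \<alpha> G p)"
  proof (rule elementary_witness[OF M(1), where k = 3 and e = "(\<lambda>_. \<kappa>)(1 := G, 2 := p)" and
        Q = "\<lambda>e \<alpha>. \<alpha> \<in> elts (e 0) \<and> (\<exists>h\<in>D. venumerates h \<alpha> (e 1) (e 2))", simplified])
    show "definable_on D (\<lambda>e. e 3 \<in> elts (e 0) \<and> (\<exists>h\<in>D. venumerates h (e 3) (e (Suc 0)) (e 2)))"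
      by (intro definable_conj definable_mem definable_ex_venumerates)
  qed (use GM \<kappa>M MD ex trans_D in auto)
  then obtain \<alpha> where \<alpha>: "\<alpha> \<in> M" "\<alpha> \<in> elts \<kappa>" "\<exists>h\<in>D. venumerates h \<alpha> G p" by blast
  have "\<exists>h\<in>M. venumerates h \<alpha> G p"
  proof (rule elementary_witness[OF M(1), where k = 3 and e = "(\<lambda>_. \<alpha>)(1 := G, 2 := p)" and
        Q = "\<lambda>e h. venumerates h (e 0) (e 1) (e 2)", simplified])
    show "definable_on D (\<lambda>e. venumerates (e 3) (e 0) (e (Suc 0)) (e 2))"
      by (rule definable_venumerates)
  qed (use GM \<alpha> in auto)
  then obtain h where h: "h \<in> M" "venumerates h \<alpha> G p" by blast
  then obtain \<beta> where \<beta>: "\<beta> \<in> elts \<alpha>" "vpair \<beta> g \<in> elts h"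
    using g by (auto simp: venumerates_def)
  have "\<beta> \<in> M"
    using M(2) \<alpha>(1,2) \<beta>(1) vordinal_trans[OF \<kappa> \<alpha>(2) \<beta>(1)]
    unfolding stable_def initial_segment_def by blast
  have "\<exists>t\<in>M. t \<in> elts G \<and> vpair \<beta> t \<in> elts h"
  proof (rule elementary_witness[OF M(1), where k = 3 and e = "(\<lambda>_. G)(1 := \<beta>, 2 := h)" and
        Q = "\<lambda>e t. t \<in> elts (e 0) \<and> vpair (e 1) t \<in> elts (e 2)", simplified])
    show "definable_on D (\<lambda>e. e 3 \<in> elts (e 0) \<and> vpair (e (Suc 0)) (e 3) \<in> elts (e 2))"
      by (intro definable_conj definable_mem definable_vpair_mem)
  qed (use GM h(1) \<open>\<beta> \<in> M\<close> MD g \<beta>(2) trans_D in auto)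
  \<comment> \<open>\<open>h\<close> is single-valued at \<open>\<beta>\<close>, so the witness
    found in \<open>M\<close> is \<open>g\<close>.\<close>
  then show "g \<in> M"
    using h(2) \<beta> g unfolding venumerates_def by blast
qed

text \<open>Elementarity moves \<open>G\<close> into \<open>M\<close>. Then
  \<open>elts G \<inter> r \<subseteq> M\<close> for every named \<open>r\<close>, hence also for
  ultrafilters covered by named ones, and equal traces on \<open>M\<close> give equal traces on
  \<open>G\<close>.\<close>

lemma vcorson_imp_good:
  assumes M: "elementary_submodel M (H \<theta>)" "stable \<kappa> M" and B: "code B \<in> M"
    and \<kappa>: "vordinal \<kappa>"
    and ex: "\<exists>G\<in>H \<theta>. vcorson_in (H \<theta>) vcarrier vmeet (zero B) (one B) \<kappa> G"
  shows "good B M"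
proof -
  interpret transitive_class "H \<theta>" by (rule transitive_class_H)
  have MD: "M \<subseteq> H \<theta>" using M by (simp add: elementary_submodel_def)
  note pairs = elementary_vpair[OF M(1) transitive_class_H]
  note code1 = pairs[OF B[unfolded code_def]]
  note code2 = pairs[OF code1(2)]
  note code3 = pairs[OF code2(2)]
  note code4 = pairs[OF code3(2)]
  note code5 = pairs[OF code4(2)]
  have \<kappa>M: "\<kappa> \<in> M" using M(2) by (simp add: stable_def)
  have "\<exists>G\<in>M. vcorson_in (H \<theta>) vcarrier vmeet (zero B) (one B) \<kappa> G"
  proof (rule elementary_witness[OF M(1), where k = 5 and
        e = "(\<lambda>_. vcarrier)(1 := vmeet, 2 := zero B, 3 := one B, 4 := \<kappa>)" and
        Q = "\<lambda>e G. vcorson_in (H \<theta>) (e 0) (e 1) (e 2) (e 3) (e 4) G", simplified])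
    show "definable_on (H \<theta>) (\<lambda>e. vcorson_in (H \<theta>) (e 0) (e (Suc 0)) (e 2) (e 3) (e 4) (e 5))"
      by (rule definable_vcorson)
  qed (use code1 code2 code5 \<kappa>M ex in auto)
  then obtain G where G: "G \<in> M" "vcorson_in (H \<theta>) vcarrier vmeet (zero B) (one B) \<kappa> G" by blast
  have vult: "vultrafilter_in (H \<theta>) vcarrier vmeet (zero B) (one B) p \<longleftrightarrow> elts p \<in> Ult B" for p
    using code1(1) MD H_subset by (intro vultrafilter_iff) auto
  have UltH: "vset p \<in> H \<theta>" if "p \<in> Ult B" for p
    using H_subset[of vcarrier \<theta> "vset p"] code1(1) MD Ult_carrier[OF that]
    by (auto simp: elts_vset_Ult[OF that] elts_vcarrier)
  have sub: "elts G \<inter> r \<subseteq> M" if "r \<in> Ult B" "vset r \<in> M" for r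
  proof -
    have "\<exists>\<alpha>\<in>elts \<kappa>. \<exists>h\<in>H \<theta>. venumerates h \<alpha> G (vset r)"
      using G(2) UltH[OF that(1)] that(1) vult[of "vset r"] elts_vset_Ult[OF that(1)]
      by (simp add: vcorson_in_def)
    from enumerated_subset_elementary[OF M transitive_class_H \<kappa> G(1) that(2) this]
    show ?thesis by (simp add: elts_vset_Ult[OF that(1)])
  qed
  show ?thesis
    unfolding good_def
  proof (intro ballI impI notI)
    fix p q assume p: "p \<in> Ult B" and q: "q \<in> Ult B"
      and pq: "p \<noteq> q \<and> p \<union> q \<subseteq> \<Union>{r \<in> Ult B. vset r \<in> M}" and eq: "p \<inter> M = q \<inter> M"
    have "elts G \<inter> p \<subseteq> M" "elts G \<inter> q \<subseteq> M"
      using pq sub by blast+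
    then have "\<forall>g\<in>elts G. g \<in> elts (vset p) \<longleftrightarrow> g \<in> elts (vset q)"
      using eq by (auto simp: elts_vset_Ult[OF p] elts_vset_Ult[OF q])
    then have "vset p = vset q"
      using G(2) UltH[OF p] UltH[OF q] vult elts_vset_Ult[OF p] elts_vset_Ult[OF q] p q
      unfolding vcorson_in_def vseparating_def by auto
    then show False using pq vset_Ult_inject[OF p q] by simp
  qed
qed

lemma Corson_imp_property:
  assumes \<kappa>: "vcardinal \<kappa>" and corson: "Corson \<kappa> B"
  shows "property_B \<kappa> B"
proof -
  obtain G where G: "G \<subseteq> carrier B" "generated B G = carrier B" "\<And>p. p \<in> Ult B \<Longrightarrow> |G \<inter> p| <o |elts \<kappa>|"
    using corson by (auto simp: Corson_def)
  have GV: "G \<in> range elts" using range_elts_subset[OF carrier_range G(1)] .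
  have "\<exists>h. \<exists>\<alpha>\<in>elts \<kappa>. venumerates h \<alpha> (vset G) p" if p: "elts p \<in> Ult B" for p
    using exists_enumeration[OF \<kappa> GV G(3)[OF p]] by simp
  then obtain h where h: "\<And>p. elts p \<in> Ult B \<Longrightarrow> \<exists>\<alpha>\<in>elts \<kappa>. venumerates (h p) \<alpha> (vset G) p"
    by metis
  \<comment> \<open>\<open>\<mu>\<close> has to accommodate one chosen enumeration per ultrafilter.
    The carrier and its subsets lie in \<open>H \<theta>\<close> because \<open>code B\<close>
    does.\<close>
  obtain \<mu> where \<mu>: "regular_vcardinal \<mu>" "h ` vset ` Ult B \<subseteq> H \<mu>"
    using exists_large_regular_vcardinal[OF range_elts_image[OF vset_Ult_range]] by metis
  have "good B M" if \<theta>: "elts \<mu> \<subseteq> elts \<theta>" and M: "elementary_submodel M (H \<theta>)" "stable \<kappa> M" "code B \<in> M"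
    for \<theta> M
  proof (rule vcorson_imp_good[OF M])
    show "vordinal \<kappa>" using \<kappa> by (simp add: vcardinal_def)
    have "code B \<in> H \<theta>" using M by (auto simp: elementary_submodel_def)
    then have C: "vcarrier \<in> H \<theta>" unfolding code_def by (rule H_vpair)
    then have vult: "vultrafilter_in (H \<theta>) vcarrier vmeet (zero B) (one B) p \<longleftrightarrow> elts p \<in> Ult B" for p
      using H_subset by (intro vultrafilter_iff) auto
    have "vset G \<in> H \<theta>"
      using H_subset[OF C, of "vset G"] G(1) by (simp add: elts_vset[OF GV] elts_vcarrier)
    moreover have "vcorson_in (H \<theta>) vcarrier vmeet (zero B) (one B) \<kappa> (vset G)"
      unfolding vcorson_in_def vseparating_def vult elts_vset[OF GV]
    proof (intro conjI ballI impI; (elim conjE)?)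
      fix p q assume "elts p \<in> Ult B" "elts q \<in> Ult B" "\<forall>g\<in>G. g \<in> elts p \<longleftrightarrow> g \<in> elts q"
      then have "elts p = elts q" using generated_separates[OF G(1,2)] by blast
      then show "p = q" by (simp add: elts_inject)
    next
      fix p assume p: "elts p \<in> Ult B"
      then have "p \<in> vset ` Ult B" by (metis imageI vset_elts)
      then have "h p \<in> H \<theta>" using \<mu>(2) H_mono[OF \<theta>] by blast
      then show "\<exists>\<alpha>\<in>elts \<kappa>. \<exists>h\<in>H \<theta>. venumerates h \<alpha> (vset G) p" using h[OF p] by blast
    qed
    ultimately show "\<exists>G\<in>H \<theta>. vcorson_in (H \<theta>) vcarrier vmeet (zero B) (one B) \<kappa> G" by blast
  qed
  then show ?thesis
    using \<mu>(1) unfolding property_B_def regular_vcardinal_def by blast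
qed

end

section \<open>Algebras with the property are Corson\<close>

instance fm :: countable
  by countable_datatype

text \<open>This allows an environment to be replaced by a finite list of arguments for a Skolem
  function.\<close>

lemma sat_finite_support: "\<exists>n. \<forall>e e'. (\<forall>i<n. e i = e' i) \<longrightarrow> (sat D e \<phi> \<longleftrightarrow> sat D e' \<phi>)"
proof (induction \<phi>)
  case (Mem i j)
  show ?case by (rule exI[of _ "Suc (i + j)"]) simp
next
  case (Eq i j)
  show ?case by (rule exI[of _ "Suc (i + j)"]) simp
next
  case (Conj \<phi> \<psi>)
  then obtain m n where
    "\<forall>e e'. (\<forall>i<m. e i = e' i) \<longrightarrow> (sat D e \<phi> \<longleftrightarrow> sat D e' \<phi>)"
    "\<forall>e e'. (\<forall>i<n. e i = e' i) \<longrightarrow> (sat D e \<psi> \<longleftrightarrow> sat D e' \<psi>)" by blast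
  then show ?case
    by (intro exI[of _ "m + n"]) (metis sat.simps(4) trans_less_add1 trans_less_add2)
next
  case (Ex k \<phi>)
  then obtain n where n: "\<And>e e'. (\<forall>i<n. e i = e' i) \<Longrightarrow> sat D e \<phi> \<longleftrightarrow> sat D e' \<phi>" by blast
  have "sat D e (Ex k \<phi>) \<longleftrightarrow> sat D e' (Ex k \<phi>)" if "\<forall>i<n. e i = e' i" for e e'
  proof -
    have "sat D (e(k := x)) \<phi> \<longleftrightarrow> sat D (e'(k := x)) \<phi>" for x
      by (rule n) (use that in simp)
    then show ?thesis by simp
  qed
  then show ?case by blast
qed simp

definition list_env :: "'v \<Rightarrow> 'v list \<Rightarrow> nat \<Rightarrow> 'v" where
  "list_env d xs i = (if i < length xs then xs ! i else d)"

definition skolem :: "'v::zfc_universe set \<Rightarrow> 'v \<Rightarrow> fm \<Rightarrow> nat \<Rightarrow> 'v list \<Rightarrow> 'v" where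
  "skolem D d \<phi> k xs = (SOME x. x \<in> D \<and> sat D ((list_env d xs)(k := x)) \<phi>)"

lemma skolem:
  assumes "x \<in> D" "sat D ((list_env d xs)(k := x)) \<phi>"
  shows "skolem D d \<phi> k xs \<in> D \<and> sat D ((list_env d xs)(k := skolem D d \<phi> k xs)) \<phi>"
  unfolding skolem_def by (rule someI[of _ x]) (use assms in simp)

text \<open>Without a witness the value of \<open>skolem\<close> is arbitrary and may leave
  \<open>D\<close>, so closure is required just for values in \<open>D\<close>.\<close>

lemma elementary_submodel_if_skolem_closed:
  assumes MD: "M \<subseteq> D" and ne: "M \<noteq> {}"
    and closed: "\<And>xs \<phi> k. set xs \<subseteq> M \<Longrightarrow> skolem D d \<phi> k xs \<in> D \<Longrightarrow> skolem D d \<phi> k xs \<in> M"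
  shows "elementary_submodel M D"
proof -
  have "range e \<subseteq> M \<longrightarrow> (sat M e \<phi> \<longleftrightarrow> sat D e \<phi>)" for \<phi> e
  proof (induction \<phi> arbitrary: e)
    case (Ex k \<phi>)
    show ?case
    proof (intro impI iffI)
      assume e: "range e \<subseteq> M"
      have upd: "range (e(k := x)) \<subseteq> M" if "x \<in> M" for x
        using e that by (auto simp: image_subset_iff)
      {
        assume "sat M e (Ex k \<phi>)"
        then obtain x where "x \<in> M" "sat M (e(k := x)) \<phi>" by auto
        then have "sat D (e(k := x)) \<phi>" using Ex upd by blast
        then show "sat D e (Ex k \<phi>)" using \<open>x \<in> M\<close> MD by auto
      next
        assume "sat D e (Ex k \<phi>)"
        then obtain x where x: "x \<in> D" "sat D (e(k := x)) \<phi>" by auto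
        obtain n where n: "\<And>e e'. (\<forall>i<n. e i = e' i) \<Longrightarrow> sat D e \<phi> \<longleftrightarrow> sat D e' \<phi>"
          using sat_finite_support by blast
        \<comment> \<open>\<open>n\<close> bounds the variables on which the truth of
          \<open>\<phi>\<close> depends, so the default \<open>d\<close> has no influence.\<close>
        define xs where "xs = map e [0..<n]"
        have env: "sat D ((list_env d xs)(k := y)) \<phi> \<longleftrightarrow> sat D (e(k := y)) \<phi>" for y
          by (rule n) (simp add: list_env_def xs_def)
        let ?y = "skolem D d \<phi> k xs"
        have y: "?y \<in> D" "sat D (e(k := ?y)) \<phi>"
          using skolem[OF x(1), of d xs k \<phi>] x(2) by (simp_all add: env)
        have "set xs \<subseteq> M" using e by (auto simp: xs_def)
        then have "?y \<in> M" using closed y(1) by blast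
        moreover from this have "sat M (e(k := ?y)) \<phi>"
          using Ex upd y(2) by blast
        ultimately show "sat M e (Ex k \<phi>)" by auto
      }
    qed
  qed auto
  then show ?thesis using MD ne by (simp add: elementary_submodel_def)
qed

context boolean_algebra_vset
begin

text \<open>\<open>\<Phi>\<close> bundles the Skolem functions of \<open>H \<theta>\<close>, for one
  sufficiently large \<open>\<theta>\<close>, with the closure conditions for stability and for the
  locale. Small closed sets then yield submodels to which Property B applies.\<close>

lemma property_imp_good_closure:
  assumes \<kappa>: "regular_vcardinal \<kappa>" "uncountable_vcardinal \<kappa>" and prop_B: "property_B \<kappa> B"
  shows "\<exists>\<Phi>. good_closure B |elts \<kappa>| \<Phi>"
proof -
  interpret regular_uncountable "|elts \<kappa>|"
    using \<kappa> by unfold_locales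
      (simp_all add: regular_vcardinal_def uncountable_vcardinal_def card_of_Card_order del: Field_card_of)
  obtain \<mu> where \<mu>: "vcardinal \<mu>"
    and good: "\<And>\<theta> M. \<lbrakk>regular_vcardinal \<theta>; elts \<mu> \<subseteq> elts \<theta>; elementary_submodel M (H \<theta>); stable \<kappa> M;
      code B \<in> M; small M\<rbrakk> \<Longrightarrow> good B M"
    using prop_B unfolding property_B_def by blast
  have "elts \<mu> \<union> {code B, \<kappa>} \<in> range elts"
    using range_elts_Un[OF rangeI range_elts_finite[of "{code B, \<kappa>}"]] by simp
  then obtain \<theta> where \<theta>: "regular_vcardinal \<theta>" "|elts \<mu> \<union> {code B, \<kappa>}| <o |elts \<theta>|"
    and in_H: "code B \<in> H \<theta>" "\<kappa> \<in> H \<theta>"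
    using exists_large_regular_vcardinal by (metis UnCI insertCI subsetD)
  have "|elts \<mu>| <o |elts \<theta>|"
    by (rule ordLeq_ordLess_trans[OF card_of_mono1 \<theta>(2)]) auto
  then have \<mu>\<theta>: "elts \<mu> \<subseteq> elts \<theta>"
    using \<mu> \<theta>(1) by (intro vordinal_subset_if_card_less) (simp_all add: regular_vcardinal_def vcardinal_def)
  have C: "vcarrier \<in> H \<theta>" using in_H(1) unfolding code_def by (rule H_vpair)
  have carrierH: "carrier B \<subseteq> H \<theta>" using H_elts[OF C] by (auto simp: elts_vcarrier)
  have UltH: "vset p \<in> H \<theta>" if "p \<in> Ult B" for p
    using H_subset[OF C, of "vset p"] Ult_carrier[OF that] by (auto simp: elts_vset_Ult[OF that] elts_vcarrier)

  \<comment> \<open>The code of a chosen ultrafilter through \<open>x\<close>, with an arbitrary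
    value if there is none.\<close>
  define u where "u x = vset (SOME r. r \<in> Ult B \<and> x \<in> r)" for x
  \<comment> \<open>Ordinals below \<open>\<kappa>\<close> contribute all their members, for
    stability. They have fewer than \<open>\<kappa>\<close> members and there are countably many
    formulas, so the values of \<open>\<Phi>\<close> are small.\<close>
  define \<Phi> where "\<Phi> xs = {code B, \<kappa>, zero B, one B} \<union>
    (\<lambda>(\<phi>, k). skolem (H \<theta>) (code B) \<phi> k xs) ` UNIV \<union> (\<Union>x \<in> set xs \<inter> elts \<kappa>. elts x) \<union>
    (\<Union>x \<in> set xs. {u x, compl B x}) \<union> (\<Union>x \<in> set xs. \<Union>y \<in> set xs. {meet B x y, join B x y})" for xs
  have \<Phi>: "{code B, \<kappa>, zero B, one B} \<subseteq> M"
    "\<And>xs \<phi> k. set xs \<subseteq> M \<Longrightarrow> skolem (H \<theta>) (code B) \<phi> k xs \<in> M"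
    "\<And>x. x \<in> M \<Longrightarrow> x \<in> elts \<kappa> \<Longrightarrow> elts x \<subseteq> M"
    "\<And>x. x \<in> M \<Longrightarrow> u x \<in> M \<and> compl B x \<in> M"
    "\<And>x y. x \<in> M \<Longrightarrow> y \<in> M \<Longrightarrow> meet B x y \<in> M \<and> join B x y \<in> M"
    if M: "op_closed \<Phi> M" for M
  proof -
    show "{code B, \<kappa>, zero B, one B} \<subseteq> M"
      using op_closedD[OF M, of "[]"] by (simp add: \<Phi>_def)
    show "skolem (H \<theta>) (code B) \<phi> k xs \<in> M" if "set xs \<subseteq> M" for xs \<phi> k
      using op_closedD[OF M that] by (auto simp: \<Phi>_def)
    show "elts x \<subseteq> M" if "x \<in> M" "x \<in> elts \<kappa>" for x
      using op_closedD[OF M, of "[x]"] that by (auto simp: \<Phi>_def)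
    show "u x \<in> M \<and> compl B x \<in> M" if "x \<in> M" for x
      using op_closedD[OF M, of "[x]"] that by (simp add: \<Phi>_def)
    show "meet B x y \<in> M \<and> join B x y \<in> M" if "x \<in> M" "y \<in> M" for x y
      using op_closedD[OF M, of "[x, y]"] that by (simp add: \<Phi>_def)
  qed
  have "good_closure B |elts \<kappa>| \<Phi>"
  proof unfold_locales
    fix xs
    have "|UNIV :: (fm \<times> nat) set| \<le>o |UNIV :: nat set|"
      using card_of_ordLeq[of "UNIV :: (fm \<times> nat) set" "UNIV :: nat set"] inj_to_nat by auto
    then have "small (UNIV :: (fm \<times> nat) set)"
      using small_nat ordLeq_ordLess_trans by blast
    moreover have "small (elts x)" if "x \<in> elts \<kappa>" for x
      using \<kappa>(1) that by (simp add: regular_vcardinal_def vcardinal_def)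
    ultimately show "small (\<Phi> xs)"
      unfolding \<Phi>_def by (intro small_Un small_UN small_image) (auto intro: small_finite)
  next
    fix M assume M: "op_closed \<Phi> M" and sM: "small M"
    \<comment> \<open>Skolem values may leave \<open>H \<theta>\<close>, so \<open>M\<close> is cut
      down to it. The carrier and the codes of ultrafilters lie in \<open>H \<theta>\<close>, so
      goodness of \<open>?M\<close> is goodness of \<open>M\<close>.\<close>
    let ?M = "M \<inter> H \<theta>"
    have "elementary_submodel ?M (H \<theta>)"
      by (rule elementary_submodel_if_skolem_closed[where d = "code B"]) (use \<Phi>[OF M] in_H in auto)
    moreover have "stable \<kappa> ?M"
      using \<Phi>(1,3)[OF M] in_H H_elts by (auto simp: stable_def initial_segment_def)
    moreover have "code B \<in> ?M" using \<Phi>(1)[OF M] in_H by simp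
    moreover have "small ?M" using small_subset[OF sM] by auto
    ultimately have "good B ?M" using good[OF \<theta>(1) \<mu>\<theta>] by blast
    moreover have "{r \<in> Ult B. vset r \<in> ?M} = {r \<in> Ult B. vset r \<in> M}"
      using UltH by auto
    moreover have "p \<inter> ?M = p \<inter> M" if "p \<in> Ult B" for p
      using carrierH Ult_carrier[OF that] by auto
    ultimately show "good B M" unfolding good_def by simp
  next
    fix M x assume M: "op_closed \<Phi> M" and x: "x \<in> M" "x \<in> carrier B" "x \<noteq> zero B"
    have "(SOME r. r \<in> Ult B \<and> x \<in> r) \<in> Ult B \<and> x \<in> (SOME r. r \<in> Ult B \<and> x \<in> r)"
      by (rule someI_ex) (use nonzero_in_Ult[OF x(2,3)] in auto)
    then show "x \<in> \<Union>(named_Ult B M)"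
      using \<Phi>(4)[OF M x(1)] unfolding named_Ult_def u_def by blast
  qed (use \<Phi> in auto)
  then show ?thesis by blast
qed

end

lemma boolean_algebra_vset_iff: "is_boolean_algebra B \<longleftrightarrow> boolean_algebra_vset B"
  by (simp add: is_boolean_algebra_def boolean_algebra_vset_def boolean_algebra_vset_axioms_def)

theorem theorem3p4:
  fixes \<kappa> :: "'v::zfc_universe" and B :: "'v bool_alg"
  assumes "regular_vcardinal \<kappa>" and "uncountable_vcardinal \<kappa>"
    and "is_boolean_algebra B"
  shows "Corson \<kappa> B \<longleftrightarrow> property_B \<kappa> B"
proof
  interpret boolean_algebra_vset B
    using assms(3) by (simp add: boolean_algebra_vset_iff)
  show "property_B \<kappa> B" if "Corson \<kappa> B"
    using Corson_imp_property[OF _ that] assms(1) by (simp add: regular_vcardinal_def)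
  assume "property_B \<kappa> B"
  then obtain \<Phi> where "good_closure B |elts \<kappa>| \<Phi>"
    using property_imp_good_closure assms(1,2) by blast
  then interpret good_closure B "|elts \<kappa>|" \<Phi> .
  show "Corson \<kappa> B"
    using exists_small_generators by (auto simp: Corson_def)
qed

end
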